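(* Let $q$ be a prime power, $n,s,k,m$ positive integers and $A=\mathrm M_n(\mathbb F_{q^s})$ regarded as an $\mathbb F_q$-algebra. Then $A^m$ can be generated by $k$ elements as an $\mathbb F_q$-algebra if and only if \[m\le\frac{|\mathrm{Gen}_k(A,\mathbb F_q)|}{s\,|\mathrm{PGL}_n(\mathbb F_{q^s})|}.\] Moreover, \[|\mathrm{Gen}_k(A^m,\mathbb F_q)|=\prod_{i=0}^{m-1}\bigl(|\mathrm{Gen}_k(A,\mathbb F_q)|-i\cdot s\cdot|\mathrm{PGL}_n(\mathbb F_{q^s})|\bigr).\]
   Context: $\mathrm{Gen}_k(B,\mathbb F_q)$ denotes the set of $k$-tuples of elements of $B$ generating $B$ as a unital $\mathbb F_q$-algebra (the non-commutative monomials in them, including $1$, span $B$). *)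

theory Defs
  imports "HOL-Computational_Algebra.Primes" "Jordan_Normal_Form.Matrix"
begin

(* A finite-dimensional unital algebra over a subfield K of the scalar type 'f is
   described by explicit data: carrier B, addition, z0, multiplication, o1,
   and scalar multiplication by elements of K. *)

definition monomial :: "('b \<Rightarrow> 'b \<Rightarrow> 'b) \<Rightarrow> 'b \<Rightarrow> 'b list \<Rightarrow> nat list \<Rightarrow> 'b" where
  "monomial mu o1 g w = foldr mu (map (\<lambda>i. g ! i) w) o1"

definition lincomb ::
  "('b \<Rightarrow> 'b \<Rightarrow> 'b) \<Rightarrow> 'b \<Rightarrow> ('b \<Rightarrow> 'b \<Rightarrow> 'b) \<Rightarrow> 'b \<Rightarrow> ('f \<Rightarrow> 'b \<Rightarrow> 'b)
    \<Rightarrow> 'b list \<Rightarrow> ('f \<times> nat list) list \<Rightarrow> 'b" where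
  "lincomb ad z0 mu o1 smul g L =
     foldr (\<lambda>(c, w) acc. ad (smul c (monomial mu o1 g w)) acc) L z0"

definition Gen ::
  "nat \<Rightarrow> 'b set \<Rightarrow> ('b \<Rightarrow> 'b \<Rightarrow> 'b) \<Rightarrow> 'b \<Rightarrow> ('b \<Rightarrow> 'b \<Rightarrow> 'b) \<Rightarrow> 'b
    \<Rightarrow> ('f \<Rightarrow> 'b \<Rightarrow> 'b) \<Rightarrow> 'f set \<Rightarrow> 'b list set" where
  "Gen k B ad z0 mu o1 smul K =
     {g. length g = k \<and> set g \<subseteq> B \<and>
         B = {lincomb ad z0 mu o1 smul g L | L.
                \<forall>(c, w) \<in> set L. c \<in> K \<and> set w \<subseteq> {..<k}}}"

definition Gen_Mat :: "nat \<Rightarrow> nat \<Rightarrow> 'f::field set \<Rightarrow> 'f mat list set" where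
  "Gen_Mat k n K = Gen k (carrier_mat n n) (+) (0\<^sub>m n n) (*) (1\<^sub>m n) (\<lambda>c M. c \<cdot>\<^sub>m M) K"

definition pow_carrier :: "nat \<Rightarrow> nat \<Rightarrow> 'f::field mat list set" where
  "pow_carrier m n = {xs. length xs = m \<and> set xs \<subseteq> carrier_mat n n}"

definition Gen_Pow :: "nat \<Rightarrow> nat \<Rightarrow> nat \<Rightarrow> 'f::field set \<Rightarrow> 'f mat list list set" where
  "Gen_Pow k m n K = Gen k (pow_carrier m n) (map2 (+)) (replicate m (0\<^sub>m n n))
      (map2 (*)) (replicate m (1\<^sub>m n)) (\<lambda>c xs. map (\<lambda>M. c \<cdot>\<^sub>m M) xs) K"

definition GL :: "nat \<Rightarrow> 'f::field mat set" where
  "GL n = {M \<in> carrier_mat n n. invertible_mat M}"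

definition PGL :: "nat \<Rightarrow> 'f::field mat set set" where
  "PGL n = (\<lambda>M. {c \<cdot>\<^sub>m M | c. c \<noteq> 0}) ` GL n"

definition is_subfield :: "'f::field set \<Rightarrow> bool" where
  "is_subfield K \<longleftrightarrow> 0 \<in> K \<and> 1 \<in> K \<and> (\<forall>x\<in>K. \<forall>y\<in>K. x + y \<in> K \<and> x * y \<in> K)
     \<and> (\<forall>x\<in>K. - x \<in> K) \<and> (\<forall>x\<in>K. inverse x \<in> K)"

definition prime_power :: "nat \<Rightarrow> bool" where
  "prime_power q \<longleftrightarrow> (\<exists>p e. prime p \<and> e > 0 \<and> q = p ^ e)"

end

theory Submission
  imports Defs "Jordan_Normal_Form.Char_Poly" "Jordan_Normal_Form.VS_Connect"
    "HOL-Number_Theory.Residues"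
begin

text \<open>
  A \<open>k\<close>-tuple of \<open>A\<^sup>m\<close> is an \<open>m\<close>-tuple of \<open>k\<close>-tuples of \<open>A\<close>. By simplicity of \<open>A\<close> and the Chinese
  remainder argument it generates \<open>A\<^sup>m\<close> iff its components generate \<open>A\<close> and have pairwise different
  ideals of relations. Two generating tuples of \<open>A\<close> have the same relations iff an
  \<open>F\<^sub>q\<close>-automorphism of \<open>A\<close> carries one to the other, and this automorphism is unique. By
  Skolem--Noether every automorphism is \<open>X \<mapsto> P \<sigma>(X) P\<^sup>-\<^sup>1\<close> with \<open>\<sigma>\<close> in the Galois group, of order \<open>s\<close>,
  and \<open>P\<close> unique up to scalars. So the classes of tuples with equal relations all have
  \<open>s |PGL\<^sub>n|\<close> elements, and choosing components one after the other in new classes gives the product.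
\<close>

section \<open>Galois group of a finite field\<close>

text \<open>The scalar type \<open>'f\<close> is the big field and F_q is its subset
  \<open>K\<close>. Generation uses coefficients from \<open>K\<close> only, so an automorphism of A
  may move scalars outside \<open>K\<close>. The centre of A is the big field and in general not
  \<open>K\<close>, hence the central simple form of Skolem--Noether does not apply directly: the
  action on the centre has to be split off as a field automorphism first, and this is the source of
  the factor s. Different relation ideals are enough for the Chinese remainder argument because each
  has the simple quotient A and is therefore maximal, so two different ones are comaximal. Classes
  of equal size c = s |PGL_n| give |Gen_k(A)| = r c, where r is the number of classes. The factors
  of the product are then (r - i) c, so the product is nonzero iff m <= r, and this is the stated
  bound.\<close>

definition gal :: "'f::field set \<Rightarrow> ('f \<Rightarrow> 'f) set" where
  "gal K = {\<sigma>. (\<forall>x y. \<sigma> (x + y) = \<sigma> x + \<sigma> y) \<and> (\<forall>x y. \<sigma> (x * y) = \<sigma> x * \<sigma> y) \<and> (\<forall>x\<in>K. \<sigma> x = x)}"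

lemma gal_comm_ring_hom:
  assumes "is_subfield K" "\<sigma> \<in> gal K"
  shows "comm_ring_hom \<sigma>"
proof -
  have "\<sigma> 0 = 0" "\<sigma> 1 = 1" using assms by (auto simp: gal_def is_subfield_def)
  then show ?thesis using assms(2) by unfold_locales (auto simp: gal_def)
qed

text \<open>Together with \<open>gal_comm_ring_hom\<close> this justifies the name
  \<open>gal\<close>: the values at 0 and 1 come from fixing \<open>K\<close>, injectivity from
  inverses in the field, and surjectivity from finiteness.\<close>

lemma gal_bij:
  fixes K :: "'f::{finite,field} set"
  assumes "is_subfield K" "\<sigma> \<in> gal K"
  shows "bij \<sigma>"
proof -
  interpret comm_ring_hom \<sigma> by (rule gal_comm_ring_hom[OF assms])
  have "inj \<sigma>"
  proof (rule injI)
    fix x y assume "\<sigma> x = \<sigma> y"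
    then have *: "\<sigma> (x - y) = 0" by (simp add: hom_minus)
    show "x = y"
    proof (rule ccontr)
      assume "x \<noteq> y"
      then have "\<sigma> ((x - y) * inverse (x - y)) = 1" by simp
      then show False using * by (simp only: hom_mult) simp
    qed
  qed
  then show ?thesis by (simp add: bij_def finite_UNIV_inj_surj)
qed

text \<open>Multiplication by a nonzero x permutes \<open>K - {0}\<close>, so the product of all
  nonzero elements absorbs the factor \<open>x ^ (card K - 1)\<close>.\<close>

lemma subfield_power_card:
  assumes K: "is_subfield K" "finite K" and x: "x \<in> K"
  shows "x ^ card K = x"
proof (cases "x = 0")
  case False
  have K0: "0 \<in> K" and c: "card K > 0" using K by (auto simp: is_subfield_def card_gt_0_iff)
  have cl: "y / x \<in> K" "x * y \<in> K" if "y \<in> K" for y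
    using K(1) x that by (auto simp: is_subfield_def divide_inverse)
  have "(\<Prod>y\<in>K-{0}. x * y) = x ^ (card K - 1) * \<Prod>(K-{0})"
    using K(2) K0 by (simp add: prod.distrib)
  moreover have "(\<Prod>y\<in>K-{0}. x * y) = \<Prod>(K-{0})"
    by (rule prod.reindex_bij_witness[of _ "\<lambda>y. y / x" "\<lambda>y. x * y"]) (use False cl in auto)
  moreover have "\<Prod>(K-{0}) \<noteq> 0" using K(2) by simp
  ultimately have "x ^ (card K - 1) = 1" by simp
  then have "x ^ Suc (card K - 1) = x" by simp
  then show ?thesis using c by simp
next
  case True
  have "card K > 0" using K x by (auto simp: card_gt_0_iff)
  then show ?thesis using True by simp
qed

lemma subfield_card_ge_2:
  assumes K: "is_subfield K" "finite K"
  shows "card K \<ge> 2"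
proof -
  have "{0, 1} \<subseteq> K" using K by (auto simp: is_subfield_def)
  from card_mono[OF K(2) this] show ?thesis by simp
qed

text \<open>Since i < j, the polynomial X^j - X^i has degree exactly j. With i = 1 this bounds the
  fixed points of Frobenius; with powers of q as exponents it keeps the powers of Frobenius
  apart.\<close>

lemma card_power_eq_power_le:
  assumes "i < (j::nat)"
  shows "card {x :: 'f::field. x ^ j = x ^ i} \<le> j"
proof -
  let ?p = "Polynomial.monom 1 j - Polynomial.monom 1 i :: 'f poly"
  have d: "degree ?p = j"
    using assms by (subst diff_conv_add_uminus, subst degree_add_eq_left)
      (auto simp: degree_monom_eq)
  then have "?p \<noteq> 0" using assms by auto
  from card_poly_roots_bound[OF this] d show ?thesis by (simp add: poly_monom)
qed

text \<open>The root bound leaves no room outside \<open>K\<close>. This is the descent criterion by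
  which Frobenius-invariant coefficients are recognised as elements of \<open>K\<close>.\<close>

lemma subfield_eq_fixed_points:
  fixes K :: "'f::{finite,field} set"
  assumes K: "is_subfield K"
  shows "{x. x ^ card K = x} = K"
proof -
  have "K \<subseteq> {x. x ^ card K = x}" using subfield_power_card[OF K] by auto
  moreover have "card {x::'f. x ^ card K = x} \<le> card K"
    using card_power_eq_power_le[of 1 "card K"] subfield_card_ge_2[OF K] by simp
  ultimately show ?thesis
    by (metis card_seteq finite)
qed

text \<open>A generator of the multiplicative group serves as a primitive element: a field
  automorphism is determined by its value there.\<close>

lemma finite_field_cyclic:
  obtains a :: "'f::{finite,field}" where "\<And>x. x \<noteq> 0 \<Longrightarrow> \<exists>i::nat. x = a ^ i"
proof -
  have "\<exists>a\<in>carrier (mult_of (class_ring :: 'f ring)).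
      carrier (mult_of (class_ring :: 'f ring)) = {a [^]\<^bsub>class_ring\<^esub> i | i::nat. i \<in> UNIV}"
    by (rule field.finite_field_mult_group_has_gen[OF class_field]) simp
  then obtain a :: 'f where "UNIV - {0} = {a ^ i | i::nat. True}"
    by (auto simp: class_ring_simps)
  then show thesis using that[of a] by blast
qed

text \<open>Additivity is the freshman's dream: the characteristic divides the cardinality of the
  field, a power of p, so it is p, and q is a power of it.\<close>

lemma frobenius_power_in_gal:
  fixes K :: "'f::{finite,field} set"
  assumes "is_subfield K" "prime_power (card K)" "card (UNIV :: 'f set) = card K ^ s"
  shows "(\<lambda>x. x ^ (card K ^ i)) \<in> gal K"
proof -
  obtain p e where p: "prime p" "e > 0" "card K = p ^ e"
    using assms(2) unfolding prime_power_def by blast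
  have pc: "prime CHAR('f)" using prime_CHAR_semidom finite_imp_CHAR_pos by (metis finite)
  have "CHAR('f) dvd p ^ (e * s)"
    using CHAR_dvd_CARD[where 'a='f] assms(3) p(3) by (simp add: power_mult)
  then have "CHAR('f) dvd p" using pc prime_dvd_power by blast
  then have c: "CHAR('f) = p" using pc p(1) primes_dvd_imp_eq by blast
  have "x ^ (card K ^ i) = x" if "x \<in> K" for x
    using subfield_power_card[OF assms(1) _ that] by (induction i) (auto simp: power_mult)
  moreover have "(x + y) ^ (card K ^ i) = x ^ (card K ^ i) + y ^ (card K ^ i)" for x y :: 'f
    by (rule freshmans_dream'[OF pc, of _ "e * i"]) (simp add: c p(3) power_mult)
  ultimately show ?thesis by (simp add: gal_def power_mult_distrib)
qed

text \<open>The powers of Frobenius with exponents below s are different, since equality of two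
  would give a polynomial of degree q^j < q^s with q^s roots. There are no others, because the image
  of a primitive element must be one of its Frobenius conjugates.\<close>

lemma card_gal:
  fixes K :: "'f::{finite,field} set"
  assumes K: "is_subfield K" and pp: "prime_power (card K)"
    and s: "card (UNIV :: 'f set) = card K ^ s"
  shows "card (gal K) = s"
proof -
  define q where "q = card K"
  have q2: "q \<ge> 2" using subfield_card_ge_2[OF K] by (simp add: q_def)
  let ?F = "\<lambda>i (x::'f). x ^ (q ^ i)"
  have Fgal: "?F i \<in> gal K" for i
    using frobenius_power_in_gal[OF K pp s] by (simp add: q_def)
  have lt: "?F i \<noteq> ?F j" if "i < j" "j < s" for i j
  proof
    assume "?F i = ?F j"
    then have "{x :: 'f. x ^ (q ^ j) = x ^ (q ^ i)} = UNIV" by (metis (mono_tags) Collect_cong UNIV_def)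
    moreover have "q ^ i < q ^ j" using q2 that by simp
    ultimately have "q ^ s \<le> q ^ j"
      using card_power_eq_power_le[of "q ^ i" "q ^ j", where 'f='f] s by (simp add: q_def)
    then show False using q2 that by simp
  qed
  have inj: "inj_on ?F {..<s}"
  proof (rule inj_onI)
    fix i j assume "i \<in> {..<s}" "j \<in> {..<s}" "?F i = ?F j"
    then show "i = j" using lt[of i j] lt[of j i] by (metis lessThan_iff linorder_neqE_nat)
  qed
  obtain a :: 'f where a: "\<And>x. x \<noteq> 0 \<Longrightarrow> \<exists>i::nat. x = a ^ i"
    using finite_field_cyclic by blast
  \<comment> \<open>\<open>f\<close> is Frobenius-invariant, so every \<open>\<sigma>\<close> permutes its roots.\<close>
  define f where "f = (\<Prod>i<s. [:- ?F i a, 1:])"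
  \<comment> \<open>Positivity makes \<open>a\<close> itself a root of \<open>f\<close>, through the
    factor with index 0.\<close>
  have s0: "s > 0"
  proof (rule ccontr)
    assume "\<not> s > 0"
    then have "card (UNIV :: 'f set) = 1" using s by simp
    moreover have "card {0, 1 :: 'f} \<le> card (UNIV :: 'f set)" by (rule card_mono) auto
    ultimately show False by simp
  qed
  have aq: "a ^ (q ^ s) = a"
    using subfield_power_card[of "UNIV :: 'f set" a] s by (simp add: q_def is_subfield_def)
  have fK: "Polynomial.coeff f i \<in> K" for i
  proof -
    interpret Fr: comm_ring_hom "?F 1" by (rule gal_comm_ring_hom[OF K Fgal])
    interpret Frp: map_poly_comm_ring_hom "?F 1" ..
    have neg: "(- x) ^ q = - (x ^ q)" for x :: 'f using Fr.hom_uminus[of x] by simp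
    have "map_poly (?F 1) f = (\<Prod>i<s. [:- ?F (Suc i) a, 1:])"
      unfolding f_def Frp.hom_prod
      by (intro prod.cong refl) (simp add: neg power_mult[symmetric] mult.commute)
    also have "\<dots> = f"
    proof -
      \<comment> \<open>The factors with indices 0 to s are multiplied in two ways, splitting off
        the first or the last one. By \<open>aq\<close> both split-off factors are
        \<open>[:- a, 1:]\<close>, so they cancel.\<close>
      have "[:- ?F 0 a, 1:] * (\<Prod>i<s. [:- ?F (Suc i) a, 1:]) = f * [:- ?F s a, 1:]"
        using prod.lessThan_Suc_shift[of "\<lambda>i. [:- ?F i a, 1:]" s]
          prod.lessThan_Suc[of "\<lambda>i. [:- ?F i a, 1:]" s] unfolding f_def by metis
      then have "[:- a, 1:] * (\<Prod>i<s. [:- ?F (Suc i) a, 1:]) = [:- a, 1:] * f"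
        unfolding aq by (simp only: mult.commute power_0 power_one_right)
      then show ?thesis by (rule mult_left_cancel[THEN iffD1, rotated]) simp
    qed
    finally have "Polynomial.coeff (map_poly (?F 1) f) i = Polynomial.coeff f i" by simp
    then have "Polynomial.coeff f i ^ q = Polynomial.coeff f i" using q2 by (simp add: coeff_map_poly)
    then show ?thesis using subfield_eq_fixed_points[OF K] by (auto simp: q_def)
  qed
  have "\<sigma> \<in> ?F ` {..<s}" if \<sigma>: "\<sigma> \<in> gal K" for \<sigma>
  proof -
    interpret S: comm_ring_hom \<sigma> by (rule gal_comm_ring_hom[OF K \<sigma>])
    interpret Sp: map_poly_comm_ring_hom \<sigma> ..
    have "map_poly \<sigma> f = f"
      by (rule poly_eqI) (use fK \<sigma> in \<open>simp add: gal_def\<close>)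
    moreover have "poly f a = 0" using s0 by (auto simp: f_def poly_prod intro!: bexI[of _ 0])
    ultimately have "poly f (\<sigma> a) = 0" by (metis S.hom_zero S.poly_map_poly)
    then obtain i where i: "i < s" "\<sigma> a = ?F i a" by (auto simp: f_def poly_prod)
    have "\<sigma> x = ?F i x" for x
    proof (cases "x = 0")
      case False
      then obtain j where "x = a ^ j" using a by blast
      then show ?thesis using i(2) by (simp add: S.hom_power power_mult[symmetric] mult.commute)
    qed (use q2 in simp)
    then show ?thesis using i(1) by auto
  qed
  then have "gal K = ?F ` {..<s}" using Fgal by auto
  then show ?thesis using card_image[OF inj] by simp
qed

section \<open>Non-commutative polynomials in matrix tuples\<close>

text \<open>Each of the entries already chosen blocks its whole fibre of size c, and different
  images make these fibres disjoint, so the next entry avoids exactly m * c elements. The product is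
  taken over the integers because factors turn negative once the fibres are exhausted; by then no
  such list exists.\<close>

lemma card_lists_distinct_map:
  fixes f :: "'a \<Rightarrow> 'b"
  assumes "finite G" and fib: "\<And>x. x \<in> G \<Longrightarrow> card {y \<in> G. f y = f x} = c"
  shows "int (card {xs. length xs = m \<and> set xs \<subseteq> G \<and> distinct (map f xs)})
    = (\<Prod>i<m. int (card G) - int i * int c)"
proof (induction m)
  case 0
  have "{xs. length xs = 0 \<and> set xs \<subseteq> G \<and> distinct (map f xs)} = {[]}" by auto
  then show ?case by simp
next
  case (Suc m)
  define D where "D = (\<lambda>m. {xs. length xs = m \<and> set xs \<subseteq> G \<and> distinct (map f xs)})"
  define E where "E = (\<lambda>xs. {y \<in> G. f y \<in> f ` set xs})"
  have fin: "finite (D m)" unfolding D_def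
    by (rule finite_subset[OF _ finite_lists_length_eq[OF assms(1), of m]]) auto
  have cE: "card (E xs) = m * c" if "xs \<in> D m" for xs
  proof -
    have "E xs = (\<Union>x\<in>set xs. {y \<in> G. f y = f x})" by (auto simp: E_def)
    also have "card \<dots> = (\<Sum>x\<in>set xs. card {y \<in> G. f y = f x})"
      by (rule card_UN_disjoint)
        (use that assms(1) in \<open>auto simp: D_def distinct_map dest: inj_onD\<close>)
    also have "\<dots> = (\<Sum>x\<in>set xs. c)" using that fib by (intro sum.cong) (auto simp: D_def)
    also have "\<dots> = m * c" using that by (auto simp: D_def distinct_map distinct_card)
    finally show ?thesis .
  qed
  have "int (card (G - E xs)) = int (card G) - int m * int c" if "xs \<in> D m" for xs
  proof -
    have sub: "E xs \<subseteq> G" and fE: "finite (E xs)" using assms(1) by (auto simp: E_def)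
    have "card (E xs) \<le> card G" using sub assms(1) card_mono by blast
    then show ?thesis using card_Diff_subset[OF fE sub] cE[OF that] by simp
  qed
  moreover have "D (Suc m) = (\<lambda>(xs, x). x # xs) ` (SIGMA xs:D m. G - E xs)"
  proof (intro equalityI subsetI)
    fix ys assume ys: "ys \<in> D (Suc m)"
    then obtain x xs where e: "ys = x # xs" by (cases ys) (auto simp: D_def)
    then show "ys \<in> (\<lambda>(xs, x). x # xs) ` (SIGMA xs:D m. G - E xs)"
      using ys by (intro image_eqI[where x="(xs, x)"]) (auto simp: D_def E_def)
  qed (auto simp: D_def E_def)
  then have "card (D (Suc m)) = card (SIGMA xs:D m. G - E xs)"
    by (simp add: card_image inj_on_def)
  then have "int (card (D (Suc m))) = (\<Sum>xs\<in>D m. int (card (G - E xs)))"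
    using fin assms(1) by simp
  ultimately have "int (card (D (Suc m))) = int (card (D m)) * (int (card G) - int m * int c)"
    by simp
  then show ?case using Suc by (simp add: D_def)
qed

text \<open>
  A linear combination of words is kept as the list of its terms, as in \<open>lincomb\<close>; it plays the role of
  an element of the free algebra and is evaluated at tuples of matrices by \<open>ev\<close>.
\<close>

definition valid :: "nat \<Rightarrow> 'f::field set \<Rightarrow> ('f \<times> nat list) list set" where
  "valid k K = {L. \<forall>(c, w) \<in> set L. c \<in> K \<and> set w \<subseteq> {..<k}}"

abbreviation mat_mon :: "nat \<Rightarrow> 'f::field mat list \<Rightarrow> nat list \<Rightarrow> 'f mat" where
  "mat_mon n \<equiv> monomial (*) (1\<^sub>m n)"

definition ev :: "nat \<Rightarrow> 'f::field mat list \<Rightarrow> ('f \<times> nat list) list \<Rightarrow> 'f mat" where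
  "ev n = lincomb (+) (0\<^sub>m n n) (*) (1\<^sub>m n) (\<lambda>c M. c \<cdot>\<^sub>m M)"

lemma ev_Nil [simp]: "ev n h [] = 0\<^sub>m n n"
  by (simp add: ev_def lincomb_def)

lemma ev_Cons [simp]: "ev n h ((c, w) # L) = c \<cdot>\<^sub>m mat_mon n h w + ev n h L"
  by (simp add: ev_def lincomb_def)

lemma valid_Nil [simp]: "[] \<in> valid k K"
  and valid_Cons [simp]: "((c, w) # L) \<in> valid k K \<longleftrightarrow> c \<in> K \<and> set w \<subseteq> {..<k} \<and> L \<in> valid k K"
  and valid_append [simp]: "L @ M \<in> valid k K \<longleftrightarrow> L \<in> valid k K \<and> M \<in> valid k K"
  by (auto simp: valid_def)

lemma mon_Nil [simp]: "mat_mon n h [] = 1\<^sub>m n"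
  and mon_Cons [simp]: "mat_mon n h (i # w) = h ! i * mat_mon n h w"
  by (simp_all add: monomial_def)

text \<open>Linearity is over \<open>K\<close> only, which leaves room for maps that are merely
  semilinear over \<open>'f\<close>. The conditions are relative to n x n matrices because the type
  contains matrices of all shapes.\<close>

definition alg_hom :: "'f::field set \<Rightarrow> nat \<Rightarrow> ('f mat \<Rightarrow> 'f mat) \<Rightarrow> bool" where
  "alg_hom K n \<phi> \<longleftrightarrow>
     (\<forall>X\<in>carrier_mat n n. \<phi> X \<in> carrier_mat n n) \<and>
     (\<forall>X\<in>carrier_mat n n. \<forall>Y\<in>carrier_mat n n. \<phi> (X + Y) = \<phi> X + \<phi> Y) \<and>
     (\<forall>X\<in>carrier_mat n n. \<forall>Y\<in>carrier_mat n n. \<phi> (X * Y) = \<phi> X * \<phi> Y) \<and>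
     \<phi> (1\<^sub>m n) = 1\<^sub>m n \<and>
     (\<forall>c\<in>K. \<forall>X\<in>carrier_mat n n. \<phi> (c \<cdot>\<^sub>m X) = c \<cdot>\<^sub>m \<phi> X)"

lemma zero_smult_mat: "X \<in> carrier_mat n n \<Longrightarrow> (0 :: 'f::field) \<cdot>\<^sub>m X = 0\<^sub>m n n"
  by (intro eq_matI) auto

lemma one_smult_mat: "(1 :: 'f::field) \<cdot>\<^sub>m X = X"
  by (intro eq_matI) auto

lemma smult_smult_mat: "(c :: 'f::field) \<cdot>\<^sub>m (d \<cdot>\<^sub>m X) = (c * d) \<cdot>\<^sub>m X"
  by (intro eq_matI) auto

lemma alg_hom_zero:
  assumes "is_subfield K" "alg_hom K n \<phi>"
  shows "\<phi> (0\<^sub>m n n) = 0\<^sub>m n n"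
proof -
  have "0 \<in> K" "\<phi> (0\<^sub>m n n) \<in> carrier_mat n n" using assms by (auto simp: alg_hom_def is_subfield_def)
  moreover have "\<phi> (c \<cdot>\<^sub>m 0\<^sub>m n n) = c \<cdot>\<^sub>m \<phi> (0\<^sub>m n n)" if "c \<in> K" for c
    using assms(2) that unfolding alg_hom_def by (metis zero_carrier_mat)
  ultimately show ?thesis by (metis zero_carrier_mat zero_smult_mat)
qed

text \<open>Left multiplication by a single term; the empty word gives scalar multiplication. Terms
  are never collected or cancelled, since only the values under \<open>ev\<close> matter.\<close>

definition scale_left :: "'f::field \<Rightarrow> nat list \<Rightarrow> ('f \<times> nat list) list \<Rightarrow> ('f \<times> nat list) list" where
  "scale_left d w L = map (\<lambda>(c, v). (d * c, w @ v)) L"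

definition times_comb ::
  "('f::field \<times> nat list) list \<Rightarrow> ('f \<times> nat list) list \<Rightarrow> ('f \<times> nat list) list" where
  "times_comb L M = concat (map (\<lambda>(c, w). scale_left c w M) L)"

definition minus_comb ::
  "('f::field \<times> nat list) list \<Rightarrow> ('f \<times> nat list) list \<Rightarrow> ('f \<times> nat list) list" where
  "minus_comb L M = L @ scale_left (-1) [] M"

context
  fixes K :: "'f::field set" and n k :: nat and h :: "'f mat list"
  assumes K: "is_subfield K" and h: "h \<in> pow_carrier k n"
begin

lemma mon_carrier [simp]: "set w \<subseteq> {..<k} \<Longrightarrow> mat_mon n h w \<in> carrier_mat n n"
proof (induction w)
  case (Cons i w)
  have "h ! i \<in> carrier_mat n n" using Cons h by (auto simp: pow_carrier_def)
  then show ?case using Cons by auto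
qed simp

lemma mon_append:
  "set v \<subseteq> {..<k} \<Longrightarrow> set w \<subseteq> {..<k} \<Longrightarrow> mat_mon n h (v @ w) = mat_mon n h v * mat_mon n h w"
proof (induction v)
  case (Cons i v)
  have "h ! i \<in> carrier_mat n n" using Cons h by (auto simp: pow_carrier_def)
  then show ?case using Cons by (simp add: assoc_mult_mat[of _ n n _ n _ n])
next
  case Nil
  show ?case using mon_carrier[OF Nil(2)] by simp
qed

lemma ev_carrier [simp]: "L \<in> valid k K \<Longrightarrow> ev n h L \<in> carrier_mat n n"
proof (induction L)
  case (Cons a L)
  then show ?case by (cases a) simp
qed simp

lemma ev_append:
  "L \<in> valid k K \<Longrightarrow> M \<in> valid k K \<Longrightarrow> ev n h (L @ M) = ev n h L + ev n h M"
proof (induction L)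
  case (Cons a L)
  then show ?case by (cases a) (simp add: assoc_add_mat[of _ n n])
qed simp

lemma scale_left_valid:
  "d \<in> K \<Longrightarrow> set w \<subseteq> {..<k} \<Longrightarrow> L \<in> valid k K \<Longrightarrow> scale_left d w L \<in> valid k K"
  using K by (fastforce simp: valid_def scale_left_def is_subfield_def)

lemma ev_scale_left:
  "set w \<subseteq> {..<k} \<Longrightarrow> L \<in> valid k K \<Longrightarrow>
    ev n h (scale_left d w L) = d \<cdot>\<^sub>m (mat_mon n h w * ev n h L)"
proof (induction L)
  case Nil
  have "mat_mon n h w * 0\<^sub>m n n = 0\<^sub>m n n" by (rule right_mult_zero_mat[OF mon_carrier[OF Nil(1)]])
  then show ?case by (auto simp: scale_left_def)
next
  case (Cons a L)
  obtain c v where a: "a = (c, v)" by (cases a)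
  have [simp]: "mat_mon n h v \<in> carrier_mat n n" "mat_mon n h w \<in> carrier_mat n n"
    "ev n h L \<in> carrier_mat n n"
    using Cons a by auto
  have [simp]: "mat_mon n h w * mat_mon n h v \<in> carrier_mat n n" "mat_mon n h w * ev n h L \<in> carrier_mat n n"
    by (rule mult_carrier_mat[of _ n n], simp_all)+
  have "ev n h (scale_left d w (a # L))
      = (d * c) \<cdot>\<^sub>m (mat_mon n h w * mat_mon n h v) + d \<cdot>\<^sub>m (mat_mon n h w * ev n h L)"
    using Cons a by (simp add: scale_left_def mon_append)
  also have "\<dots> = d \<cdot>\<^sub>m (c \<cdot>\<^sub>m (mat_mon n h w * mat_mon n h v) + mat_mon n h w * ev n h L)"
    by (simp add: add_smult_distrib_left_mat[of _ n n] smult_smult_mat)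
  also have "\<dots> = d \<cdot>\<^sub>m (mat_mon n h w * ev n h (a # L))"
    by (simp add: a mult_add_distrib_mat[of _ n n _ n] mult_smult_distrib[of _ n n _ n])
  finally show ?case .
qed

lemma times_comb_valid: "L \<in> valid k K \<Longrightarrow> M \<in> valid k K \<Longrightarrow> times_comb L M \<in> valid k K"
proof (induction L)
  case (Cons a L)
  then show ?case by (cases a) (simp add: times_comb_def scale_left_valid)
qed (simp add: times_comb_def)

lemma ev_times_comb:
  "L \<in> valid k K \<Longrightarrow> M \<in> valid k K \<Longrightarrow> ev n h (times_comb L M) = ev n h L * ev n h M"
proof (induction L)
  case Nil
  show ?case using left_mult_zero_mat[OF ev_carrier[OF Nil(2)], of n] by (simp add: times_comb_def)
next
  case (Cons a L)
  obtain c v where a: "a = (c, v)" by (cases a)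
  have [simp]: "mat_mon n h v \<in> carrier_mat n n"
    "ev n h L \<in> carrier_mat n n" "ev n h M \<in> carrier_mat n n"
    using Cons a by auto
  have v: "c \<in> K" "set v \<subseteq> {..<k}" "L \<in> valid k K" using Cons a by auto
  have "ev n h (times_comb (a # L) M) = ev n h (scale_left c v M @ times_comb L M)"
    by (simp add: times_comb_def a)
  also have "\<dots> = c \<cdot>\<^sub>m (mat_mon n h v * ev n h M) + ev n h L * ev n h M"
    using v Cons by (simp add: ev_append ev_scale_left scale_left_valid times_comb_valid)
  also have "\<dots> = ev n h (a # L) * ev n h M"
    by (simp add: a add_mult_distrib_mat[of _ n n _ _ n] mult_smult_assoc_mat[of _ n n _ n])
  finally show ?case .
qed

lemma minus_comb_valid: "L \<in> valid k K \<Longrightarrow> M \<in> valid k K \<Longrightarrow> minus_comb L M \<in> valid k K"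
  using K by (simp add: minus_comb_def scale_left_valid is_subfield_def)

lemma ev_minus_comb:
  assumes "L \<in> valid k K" "M \<in> valid k K"
  shows "ev n h (minus_comb L M) = ev n h L - ev n h M"
proof -
  have "ev n h (minus_comb L M) = ev n h L + (-1) \<cdot>\<^sub>m (1\<^sub>m n * ev n h M)"
    using assms K by (simp add: minus_comb_def ev_append scale_left_valid ev_scale_left is_subfield_def)
  also have "\<dots> = ev n h L - ev n h M"
    using ev_carrier[OF assms(1)] ev_carrier[OF assms(2)] by (intro eq_matI) auto
  finally show ?thesis .
qed

lemma one_comb_valid: "[(1, [])] \<in> valid k K"
  using K by (simp add: is_subfield_def)

lemma ev_one_comb: "ev n h [(1, [])] = 1\<^sub>m n"
  by (simp add: one_smult_mat)

lemma ev_generator: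
  assumes "i < k"
  shows "ev n h [(1, [i])] = h ! i"
proof -
  have "h ! i \<in> carrier_mat n n" using assms h by (auto simp: pow_carrier_def)
  then show ?thesis by (simp add: one_smult_mat)
qed

lemma map_alg_hom_pow_carrier: "alg_hom K n \<phi> \<Longrightarrow> map \<phi> h \<in> pow_carrier k n"
  using h by (auto simp: pow_carrier_def alg_hom_def)

text \<open>This naturality has two uses: relations of h persist under \<phi>, and the images of a
  generating tuple determine \<phi> on all of A.\<close>

lemma ev_map_alg_hom:
  assumes \<phi>: "alg_hom K n \<phi>" and L: "L \<in> valid k K"
  shows "ev n (map \<phi> h) L = \<phi> (ev n h L)"
proof -
  have mon: "mat_mon n (map \<phi> h) w = \<phi> (mat_mon n h w)" if "set w \<subseteq> {..<k}" for w
    using that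
  proof (induction w)
    case Nil
    then show ?case using \<phi> by (simp add: alg_hom_def)
  next
    case (Cons i w)
    have "h ! i \<in> carrier_mat n n" "i < length h" using Cons h by (auto simp: pow_carrier_def)
    then show ?case using Cons \<phi> by (simp add: alg_hom_def)
  qed
  show ?thesis using L
  proof (induction L)
    case Nil
    then show ?case using alg_hom_zero[OF K \<phi>] by simp
  next
    case (Cons a L)
    obtain c v where a: "a = (c, v)" by (cases a)
    then show ?case using Cons \<phi> by (simp add: mon alg_hom_def)
  qed
qed

end

section \<open>Generation as surjectivity of evaluation, for A and for A^m\<close>

lemma eq_range_iff_covers:
  assumes "\<And>L. L \<in> V \<Longrightarrow> e L \<in> B"
  shows "B = {e L | L. L \<in> V} \<longleftrightarrow> (\<forall>X\<in>B. \<exists>L\<in>V. e L = X)"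
proof -
  have "B = {e L | L. L \<in> V} \<longleftrightarrow> B \<subseteq> e ` V" using assms by (auto simp: image_def)
  then show ?thesis by (auto simp: image_def subset_iff)
qed

lemma Gen_Mat_iff:
  assumes "is_subfield K"
  shows "h \<in> Gen_Mat k n K \<longleftrightarrow>
    h \<in> pow_carrier k n \<and> (\<forall>X\<in>carrier_mat n n. \<exists>L\<in>valid k K. ev n h L = X)"
proof -
  have "h \<in> Gen_Mat k n K \<longleftrightarrow> h \<in> pow_carrier k n \<and> carrier_mat n n = {ev n h L | L. L \<in> valid k K}"
    by (simp add: Gen_Mat_def Gen_def ev_def valid_def pow_carrier_def)
  also have "\<dots> \<longleftrightarrow>
    h \<in> pow_carrier k n \<and> (\<forall>X\<in>carrier_mat n n. \<exists>L\<in>valid k K. ev n h L = X)"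
  proof (rule conj_cong[OF refl])
    assume "h \<in> pow_carrier k n"
    then show "carrier_mat n n = {ev n h L | L. L \<in> valid k K} \<longleftrightarrow>
        (\<forall>X\<in>carrier_mat n n. \<exists>L\<in>valid k K. ev n h L = X)"
      by (intro eq_range_iff_covers ev_carrier[OF assms])
  qed
  finally show ?thesis .
qed

context
  fixes K :: "'f::field set" and n k m :: nat and g :: "'f mat list list"
  assumes K: "is_subfield K" and g: "length g = k" "set g \<subseteq> pow_carrier m n"
begin

lemma coordinate_pow_carrier: "j < m \<Longrightarrow> map (\<lambda>x. x ! j) g \<in> pow_carrier k n"
  using g by (fastforce simp: pow_carrier_def)

text \<open>\<open>map2\<close> truncates to the shorter list, so the length has to be carried
  through the induction together with the components.\<close>

lemma monomial_pow:
  assumes "set w \<subseteq> {..<k}"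
  shows "length (monomial (map2 (*)) (replicate m (1\<^sub>m n)) g w) = m \<and>
    (\<forall>j<m. monomial (map2 (*)) (replicate m (1\<^sub>m n)) g w ! j = mat_mon n (map (\<lambda>x. x ! j) g) w)"
  using assms
proof (induction w)
  case Nil
  then show ?case by (simp add: monomial_def)
next
  case (Cons i w)
  have "g ! i \<in> pow_carrier m n" using Cons g by auto
  then have "length (g ! i) = m" by (simp add: pow_carrier_def)
  then show ?case using Cons g by (simp add: monomial_def)
qed

lemma lincomb_pow:
  assumes "L \<in> valid k K"
  shows "lincomb (map2 (+)) (replicate m (0\<^sub>m n n)) (map2 (*)) (replicate m (1\<^sub>m n))
      (\<lambda>c xs. map (\<lambda>M. c \<cdot>\<^sub>m M) xs) g L = map (\<lambda>j. ev n (map (\<lambda>x. x ! j) g) L) [0..<m]"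
  using assms
proof (induction L)
  case Nil
  then show ?case by (auto simp: lincomb_def intro!: nth_equalityI)
next
  case (Cons a L)
  obtain c w where a: "a = (c, w)" by (cases a)
  then show ?case using Cons monomial_pow[of w]
    by (auto simp: lincomb_def intro!: nth_equalityI)
qed

end

lemma Gen_Pow_iff:
  assumes K: "is_subfield K"
  shows "g \<in> Gen_Pow k m n K \<longleftrightarrow> length g = k \<and> set g \<subseteq> pow_carrier m n \<and>
    (\<forall>X\<in>pow_carrier m n. \<exists>L\<in>valid k K. \<forall>j<m. ev n (map (\<lambda>x. x ! j) g) L = X ! j)"
    (is "?l = ?r")
proof (cases "length g = k \<and> set g \<subseteq> pow_carrier m n")
  case False
  then show ?thesis by (auto simp: Gen_Pow_def Gen_def)
next
  case True
  then have g: "length g = k" "set g \<subseteq> pow_carrier m n" by auto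
  let ?e = "\<lambda>L. map (\<lambda>j. ev n (map (\<lambda>x. x ! j) g) L) [0..<m]"
  have "{lincomb (map2 (+)) (replicate m (0\<^sub>m n n)) (map2 (*)) (replicate m (1\<^sub>m n))
      (\<lambda>c xs. map (\<lambda>M. c \<cdot>\<^sub>m M) xs) g L | L. L \<in> valid k K} = {?e L | L. L \<in> valid k K}"
    by (intro Collect_cong ex_cong1) (metis (no_types, lifting) lincomb_pow[OF K g])
  then have "?l \<longleftrightarrow> pow_carrier m n = {?e L | L. L \<in> valid k K}"
    using g by (simp add: Gen_Pow_def Gen_def valid_def)
  also have "\<dots> \<longleftrightarrow> (\<forall>X\<in>pow_carrier m n. \<exists>L\<in>valid k K. ?e L = X)"
  proof (rule eq_range_iff_covers)
    fix L assume "L \<in> valid k K"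
    from ev_carrier[OF K coordinate_pow_carrier[OF K g] this]
    show "?e L \<in> pow_carrier m n" by (auto simp: pow_carrier_def)
  qed
  finally have "?l \<longleftrightarrow> (\<forall>X\<in>pow_carrier m n. \<exists>L\<in>valid k K. ?e L = X)" .
  moreover have "?e L = X \<longleftrightarrow> (\<forall>j<m. ev n (map (\<lambda>x. x ! j) g) L = X ! j)"
    if "X \<in> pow_carrier m n" for L X
    using that by (auto simp: pow_carrier_def list_eq_iff_nth_eq)
  ultimately show ?thesis using g by simp
qed

text \<open>The transposed form of \<open>Gen_Pow\<close>: the entries of \<open>hs\<close> are the
  k-tuples of j-th components, and one combination \<open>L\<close> has to reach all m targets
  simultaneously.\<close>

definition joint_Gen :: "nat \<Rightarrow> nat \<Rightarrow> nat \<Rightarrow> 'f::field set \<Rightarrow> 'f mat list list set" where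
  "joint_Gen k m n K = {hs. length hs = m \<and> set hs \<subseteq> pow_carrier k n \<and>
    (\<forall>X\<in>pow_carrier m n. \<exists>L\<in>valid k K. \<forall>j<m. ev n (hs ! j) L = X ! j)}"

lemma card_Gen_Pow:
  assumes K: "is_subfield K"
  shows "card (Gen_Pow k m n K) = card (joint_Gen k m n K)"
proof -
  \<comment> \<open>Transposition. The number r of resulting lists is an argument because it cannot
    be read off an empty outer list.\<close>
  define tr :: "nat \<Rightarrow> 'a mat list list \<Rightarrow> 'a mat list list"
    where "tr = (\<lambda>r xs. map (\<lambda>j. map (\<lambda>x. x ! j) xs) [0..<r])"
  have inv: "tr b (tr a xs) = xs" if "length xs = b" "set xs \<subseteq> pow_carrier a n" for xs a b
    using that by (auto simp: tr_def pow_carrier_def subset_iff intro!: nth_equalityI)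
  have cl: "set (tr a xs) \<subseteq> pow_carrier b n" if "length xs = b" "set xs \<subseteq> pow_carrier a n" for xs a b
    using that by (auto simp: tr_def pow_carrier_def subset_iff)
  have len: "length (tr a xs) = a" for a xs by (simp add: tr_def)
  have nth: "tr a xs ! j = map (\<lambda>x. x ! j) xs" if "j < a" for a xs j using that by (simp add: tr_def)
  have "bij_betw (tr m) (Gen_Pow k m n K) (joint_Gen k m n K)"
  proof (rule bij_betw_byWitness[where f'="tr k"])
    show "\<forall>xs\<in>Gen_Pow k m n K. tr k (tr m xs) = xs"
      by (auto simp: Gen_Pow_iff[OF K] intro: inv)
    show "\<forall>xs\<in>joint_Gen k m n K. tr m (tr k xs) = xs"
      by (auto simp: joint_Gen_def intro: inv)
    show "tr m ` Gen_Pow k m n K \<subseteq> joint_Gen k m n K"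
      using cl by (auto simp: Gen_Pow_iff[OF K] joint_Gen_def len nth) blast
    show "tr k ` joint_Gen k m n K \<subseteq> Gen_Pow k m n K"
    proof
      fix g assume "g \<in> tr k ` joint_Gen k m n K"
      then obtain xs where xs: "xs \<in> joint_Gen k m n K" and g: "g = tr k xs" by blast
      then have l: "length xs = m" "set xs \<subseteq> pow_carrier k n" by (auto simp: joint_Gen_def)
      have "map (\<lambda>x. x ! j) g = xs ! j" if "j < m" for j
        using inv[OF l] that nth[of j m g] by (simp add: g)
      then show "g \<in> Gen_Pow k m n K"
        using xs cl[OF l] by (auto simp: Gen_Pow_iff[OF K] joint_Gen_def len g)
    qed
  qed
  then show ?thesis by (rule bij_betw_same_card)
qed

section \<open>Automorphisms of matrix algebras\<close>

definition unit_mat_at :: "nat \<Rightarrow> nat \<Rightarrow> nat \<Rightarrow> 'f::field mat" where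
  "unit_mat_at n i j = mat n n (\<lambda>(a, b). if a = i \<and> b = j then 1 else 0)"

lemma unit_mat_at_carrier [simp]: "unit_mat_at n i j \<in> carrier_mat n n"
  by (simp add: unit_mat_at_def)

lemma unit_mat_at_dim [simp]: "dim_row (unit_mat_at n i j) = n" "dim_col (unit_mat_at n i j) = n"
  by (simp_all add: unit_mat_at_def)

lemma unit_mat_at_index [simp]:
  "a < n \<Longrightarrow> b < n \<Longrightarrow> unit_mat_at n i j $$ (a, b) = (if a = i \<and> b = j then 1 else 0)"
  by (simp add: unit_mat_at_def)

lemma mult_mat_index:
  assumes "X \<in> carrier_mat n n" "Y \<in> carrier_mat n n" "a < n" "b < n"
  shows "(X * Y) $$ (a, b) = (\<Sum>l<n. X $$ (a, l) * Y $$ (l, b))"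
  using assms by (auto simp: scalar_prod_def atLeast0LessThan)

lemma unit_mat_at_mult_index:
  assumes "X \<in> carrier_mat n n" "a < n" "b < n" "j < n"
  shows "(unit_mat_at n i j * X) $$ (a, b) = (if a = i then X $$ (j, b) else 0)"
proof -
  have "(unit_mat_at n i j * X) $$ (a, b) = (\<Sum>l<n. (if l = j then (if a = i then X $$ (j, b) else 0) else 0))"
    unfolding mult_mat_index[OF unit_mat_at_carrier assms(1-3)]
    using assms by (intro sum.cong) auto
  then show ?thesis using assms by simp
qed

lemma mult_unit_mat_at_index:
  assumes "X \<in> carrier_mat n n" "a < n" "b < n" "i < n"
  shows "(X * unit_mat_at n i j) $$ (a, b) = (if b = j then X $$ (a, i) else 0)"
proof -
  have "(X * unit_mat_at n i j) $$ (a, b) = (\<Sum>l<n. (if l = i then (if b = j then X $$ (a, i) else 0) else 0))"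
    unfolding mult_mat_index[OF assms(1) unit_mat_at_carrier assms(2,3)]
    using assms by (intro sum.cong) auto
  then show ?thesis using assms by simp
qed

lemma central_mat_scalar:
  assumes Z: "Z \<in> carrier_mat n n"
    and comm: "\<And>i j. i < n \<Longrightarrow> j < n \<Longrightarrow> Z * unit_mat_at n i j = unit_mat_at n i j * Z"
  shows "Z = Z $$ (0, 0) \<cdot>\<^sub>m 1\<^sub>m n"
proof (rule eq_matI)
  fix a b assume "a < dim_row (Z $$ (0, 0) \<cdot>\<^sub>m 1\<^sub>m n)" "b < dim_col (Z $$ (0, 0) \<cdot>\<^sub>m 1\<^sub>m n)"
  then have ab: "a < n" "b < n" by auto
  \<comment> \<open>Position (a, 0) shows the entry (a, b) of Z on the left, and on the right the
    entry (0, 0) of Z if a = b and 0 otherwise.\<close>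
  have "(Z * unit_mat_at n b 0) $$ (a, 0) = (unit_mat_at n b 0 * Z) $$ (a, 0)"
    using comm[of b 0] ab by simp
  then have "Z $$ (a, b) = (if a = b then Z $$ (0, 0) else 0)"
    using Z ab by (simp add: unit_mat_at_mult_index mult_unit_mat_at_index del: index_mult_mat(1))
  then show "Z $$ (a, b) = (Z $$ (0, 0) \<cdot>\<^sub>m 1\<^sub>m n) $$ (a, b)" using ab by simp
qed (use Z in auto)

lemma matrix_ideal_contains_one:
  fixes X :: "'f::field mat"
  assumes add: "\<And>X Y. X \<in> I \<Longrightarrow> Y \<in> I \<Longrightarrow> X + Y \<in> I"
    and left: "\<And>X Y. X \<in> carrier_mat n n \<Longrightarrow> Y \<in> I \<Longrightarrow> X * Y \<in> I"
    and right: "\<And>X Y. Y \<in> I \<Longrightarrow> X \<in> carrier_mat n n \<Longrightarrow> Y * X \<in> I"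
    and X: "X \<in> I" "X \<in> carrier_mat n n" "X \<noteq> 0\<^sub>m n n"
  shows "1\<^sub>m n \<in> I"
proof -
  obtain a b where ab: "a < n" "b < n" "X $$ (a, b) \<noteq> 0"
    using X(2,3) by (auto simp: mat_eq_iff)
  define D where "D = (\<lambda>t. mat n n (\<lambda>(i, j). if i = j \<and> i < t then 1 else (0::'f)))"
  have "D t \<in> I" if "t \<le> n" for t
    using that
  proof (induction t)
    case 0
    have "D 0 = 0\<^sub>m n n * X" using X(2) by (intro eq_matI) (auto simp: D_def)
    then show ?case using left[OF _ X(1), of "0\<^sub>m n n"] by simp
  next
    case (Suc t)
    let ?L = "inverse (X $$ (a, b)) \<cdot>\<^sub>m unit_mat_at n t a"
    have L: "?L * X = inverse (X $$ (a, b)) \<cdot>\<^sub>m (unit_mat_at n t a * X)"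
      using X(2) by (simp add: mult_smult_assoc_mat[of _ n n _ n])
    have c: "?L * X \<in> carrier_mat n n" using X(2) by auto
    have "?L * X * unit_mat_at n b t \<in> I" using left right X(1) by simp
    moreover have "D (Suc t) = D t + ?L * X * unit_mat_at n b t"
    proof (rule eq_matI)
      fix i j assume "i < dim_row (D t + ?L * X * unit_mat_at n b t)"
        "j < dim_col (D t + ?L * X * unit_mat_at n b t)"
      then have ij: "i < n" "j < n" by auto
      have "(?L * X * unit_mat_at n b t) $$ (i, j) = (if i = t \<and> j = t then 1 else 0)"
        using Suc.prems ij ab X(2)
        by (simp add: mult_unit_mat_at_index[OF c[unfolded L]] L unit_mat_at_mult_index del: assoc_mult_mat index_mult_mat(1))
      then show "D (Suc t) $$ (i, j) = (D t + ?L * X * unit_mat_at n b t) $$ (i, j)"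
        using ij X(2) by (auto simp: D_def simp del: assoc_mult_mat index_mult_mat(1))
    qed (use X(2) in \<open>auto simp: D_def\<close>)
    ultimately show ?case using Suc add by simp
  qed
  moreover have "D n = 1\<^sub>m n" by (intro eq_matI) (auto simp: D_def)
  ultimately show ?thesis by (metis order_refl)
qed

text \<open>The expansion of Y in matrix units, pushed through \<phi>. \<open>R S\<close> is Y with
  the entries outside S erased, so Y is built up position by position and no set-indexed sum of
  matrices is needed.\<close>

lemma semilinear_expansion:
  fixes \<phi> :: "'f::field mat \<Rightarrow> 'f mat"
  assumes car: "\<And>X. X \<in> carrier_mat n n \<Longrightarrow> \<phi> X \<in> carrier_mat n n"
    and add: "\<And>X Y. X \<in> carrier_mat n n \<Longrightarrow> Y \<in> carrier_mat n n \<Longrightarrow> \<phi> (X + Y) = \<phi> X + \<phi> Y"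
    and zero: "\<phi> (0\<^sub>m n n) = 0\<^sub>m n n"
    and smult: "\<And>c X. X \<in> carrier_mat n n \<Longrightarrow> \<phi> (c \<cdot>\<^sub>m X) = \<sigma> c \<cdot>\<^sub>m \<phi> X"
    and Y: "Y \<in> carrier_mat n n" and ij: "i < n" "j < n"
  shows "\<phi> Y $$ (i, j) =
    (\<Sum>l<n. \<Sum>r<n. \<sigma> (Y $$ (l, r)) * \<phi> (unit_mat_at n l r) $$ (i, j))"
proof -
  define R where "R = (\<lambda>S. mat n n (\<lambda>lr. if lr \<in> S then Y $$ lr else 0))"
  have RC: "R S \<in> carrier_mat n n" for S by (simp add: R_def)
  have "\<phi> (R S) $$ (i, j) = (\<Sum>(l, r)\<in>S. \<sigma> (Y $$ (l, r)) * \<phi> (unit_mat_at n l r) $$ (i, j))"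
    if "finite S" "S \<subseteq> {..<n} \<times> {..<n}" for S
    using that
  proof (induction S rule: finite_induct)
    case empty
    have "R {} = 0\<^sub>m n n" by (intro eq_matI) (auto simp: R_def)
    then show ?case using zero ij by simp
  next
    case (insert x S)
    obtain l r where x: "x = (l, r)" by (cases x)
    let ?U = "unit_mat_at n l r :: 'f mat"
    have "R (insert x S) = Y $$ (l, r) \<cdot>\<^sub>m ?U + R S"
      using insert x by (intro eq_matI) (auto simp: R_def)
    then have "\<phi> (R (insert x S)) = \<sigma> (Y $$ (l, r)) \<cdot>\<^sub>m \<phi> ?U + \<phi> (R S)"
      using RC by (simp add: add smult)
    then show ?case using insert x ij car[OF RC[of S]] car[of ?U] by auto
  qed
  from this[of "{..<n} \<times> {..<n}"]
  have "\<phi> (R ({..<n} \<times> {..<n})) $$ (i, j) =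
      (\<Sum>l<n. \<Sum>r<n. \<sigma> (Y $$ (l, r)) * \<phi> (unit_mat_at n l r) $$ (i, j))"
    by (simp add: sum.cartesian_product)
  moreover have "R ({..<n} \<times> {..<n}) = Y" using Y by (intro eq_matI) (auto simp: R_def)
  ultimately show ?thesis by simp
qed

lemma GL_inverse:
  assumes "P \<in> GL n"
  obtains Q where "Q \<in> carrier_mat n n" "P * Q = 1\<^sub>m n" "Q * P = 1\<^sub>m n"
proof -
  obtain Q where P: "P \<in> carrier_mat n n" and 1: "P * Q = 1\<^sub>m n" and 2: "Q * P = 1\<^sub>m (dim_row Q)"
    using assms by (auto simp: GL_def invertible_mat_def inverts_mat_def)
  \<comment> \<open>Invertibility leaves the shape of Q open; the two products determine it.\<close>
  have "dim_col Q = n" using arg_cong[OF 1, of dim_col] by simp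
  moreover have "dim_row Q = n" using arg_cong[OF 2, of dim_col] P by simp
  ultimately show thesis using that[of Q] 1 2 by auto
qed

lemma GL_I:
  assumes "P \<in> carrier_mat n n" "Q \<in> carrier_mat n n" "Q * P = 1\<^sub>m n"
  shows "P \<in> GL n"
proof -
  have "P * Q = 1\<^sub>m n" by (rule mat_mult_left_right_inverse[OF assms(2,1,3)])
  then show ?thesis using assms by (auto simp: GL_def invertible_mat_def inverts_mat_def)
qed

text \<open>A surjective \<phi> maps scalar matrices to central ones, that is to scalars again; this
  defines \<sigma> and makes \<phi> \<sigma>-semilinear. What remains is a change of basis taking
  the matrix units to their images. The intertwining form of the conclusion avoids the inverse of
  P.\<close>

theorem semilinear_Skolem_Noether:
  fixes K :: "'f::field set"
  assumes K: "is_subfield K" and n: "n > 0" and hom: "alg_hom K n \<phi>"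
    and surj: "\<And>Y. Y \<in> carrier_mat n n \<Longrightarrow> \<exists>X\<in>carrier_mat n n. \<phi> X = Y"
    and ker: "\<And>X. X \<in> carrier_mat n n \<Longrightarrow> \<phi> X = 0\<^sub>m n n \<Longrightarrow> X = 0\<^sub>m n n"
  obtains \<sigma> P where "\<sigma> \<in> gal K" "P \<in> GL n"
    "\<And>X. X \<in> carrier_mat n n \<Longrightarrow> \<phi> X * P = P * map_mat \<sigma> X"
proof -
  let ?E = "\<lambda>i j. unit_mat_at n i j :: 'f mat"
  have car: "\<And>X. X \<in> carrier_mat n n \<Longrightarrow> \<phi> X \<in> carrier_mat n n"
    and add: "\<And>X Y. X \<in> carrier_mat n n \<Longrightarrow> Y \<in> carrier_mat n n \<Longrightarrow> \<phi> (X + Y) = \<phi> X + \<phi> Y"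
    and mult: "\<And>X Y. X \<in> carrier_mat n n \<Longrightarrow> Y \<in> carrier_mat n n \<Longrightarrow> \<phi> (X * Y) = \<phi> X * \<phi> Y"
    and one: "\<phi> (1\<^sub>m n) = 1\<^sub>m n"
    and Klin: "\<And>c X. c \<in> K \<Longrightarrow> X \<in> carrier_mat n n \<Longrightarrow> \<phi> (c \<cdot>\<^sub>m X) = c \<cdot>\<^sub>m \<phi> X"
    using hom by (auto simp: alg_hom_def)
  have zero: "\<phi> (0\<^sub>m n n) = 0\<^sub>m n n" by (rule alg_hom_zero[OF K hom])
  define \<sigma> where "\<sigma> = (\<lambda>c. \<phi> (c \<cdot>\<^sub>m 1\<^sub>m n) $$ (0, 0))"
  have scal: "(c \<cdot>\<^sub>m 1\<^sub>m n) * X = c \<cdot>\<^sub>m X" "X * (c \<cdot>\<^sub>m 1\<^sub>m n) = c \<cdot>\<^sub>m X"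
    if "X \<in> carrier_mat n n" for c :: 'f and X
    using that by (simp_all add: mult_smult_assoc_mat[of _ n n _ n] mult_smult_distrib[of _ n n _ n])
  have \<sigma>: "\<phi> (c \<cdot>\<^sub>m 1\<^sub>m n) = \<sigma> c \<cdot>\<^sub>m 1\<^sub>m n" for c
    unfolding \<sigma>_def
  proof (rule central_mat_scalar)
    show "\<phi> (c \<cdot>\<^sub>m 1\<^sub>m n) \<in> carrier_mat n n" by (simp add: car)
    fix i j :: nat
    \<comment> \<open>A preimage of the matrix unit commutes with every scalar matrix, hence the
      images commute as well.\<close>
    obtain X where X: "X \<in> carrier_mat n n" "\<phi> X = ?E i j" using surj[of "?E i j"] by auto
    have "\<phi> (c \<cdot>\<^sub>m 1\<^sub>m n) * \<phi> X = \<phi> X * \<phi> (c \<cdot>\<^sub>m 1\<^sub>m n)"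
      using X(1) by (simp add: mult[symmetric] scal)
    then show "\<phi> (c \<cdot>\<^sub>m 1\<^sub>m n) * ?E i j = ?E i j * \<phi> (c \<cdot>\<^sub>m 1\<^sub>m n)" by (simp add: X(2))
  qed
  have smult: "\<phi> (c \<cdot>\<^sub>m X) = \<sigma> c \<cdot>\<^sub>m \<phi> X" if "X \<in> carrier_mat n n" for c X
  proof -
    have "\<phi> (c \<cdot>\<^sub>m X) = \<phi> ((c \<cdot>\<^sub>m 1\<^sub>m n) * X)" using that by (simp add: scal)
    also have "\<dots> = (\<sigma> c \<cdot>\<^sub>m 1\<^sub>m n) * \<phi> X" using mult[OF _ that, of "c \<cdot>\<^sub>m 1\<^sub>m n"] by (simp add: \<sigma>)
    also have "\<dots> = \<sigma> c \<cdot>\<^sub>m \<phi> X" by (rule scal(1)[OF car[OF that]])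
    finally show ?thesis .
  qed
  have \<sigma>gal: "\<sigma> \<in> gal K"
  proof -
    have "\<sigma> (c + d) = \<sigma> c + \<sigma> d" for c d
    proof -
      have "(c + d) \<cdot>\<^sub>m 1\<^sub>m n = c \<cdot>\<^sub>m 1\<^sub>m n + d \<cdot>\<^sub>m (1\<^sub>m n :: 'f mat)"
        by (intro eq_matI) (auto simp: algebra_simps)
      then have "\<sigma> (c + d) \<cdot>\<^sub>m 1\<^sub>m n = \<sigma> c \<cdot>\<^sub>m 1\<^sub>m n + \<sigma> d \<cdot>\<^sub>m (1\<^sub>m n :: 'f mat)"
        by (simp add: add flip: \<sigma>)
      then have "(\<sigma> (c + d) \<cdot>\<^sub>m 1\<^sub>m n) $$ (0, 0) = (\<sigma> c \<cdot>\<^sub>m 1\<^sub>m n + \<sigma> d \<cdot>\<^sub>m (1\<^sub>m n :: 'f mat)) $$ (0, 0)"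
        by simp
      then show ?thesis using n by simp
    qed
    moreover have "\<sigma> (c * d) = \<sigma> c * \<sigma> d" for c d
    proof -
      have "\<sigma> (c * d) \<cdot>\<^sub>m 1\<^sub>m n = \<phi> (c \<cdot>\<^sub>m (d \<cdot>\<^sub>m 1\<^sub>m n))" by (simp add: \<sigma> smult_smult_mat)
      also have "\<dots> = \<sigma> c \<cdot>\<^sub>m \<phi> (d \<cdot>\<^sub>m 1\<^sub>m n)" by (rule smult) simp
      also have "\<dots> = (\<sigma> c * \<sigma> d) \<cdot>\<^sub>m 1\<^sub>m n" by (simp add: \<sigma> smult_smult_mat)
      finally have "(\<sigma> (c * d) \<cdot>\<^sub>m 1\<^sub>m n) $$ (0, 0) = ((\<sigma> c * \<sigma> d) \<cdot>\<^sub>m (1\<^sub>m n :: 'f mat)) $$ (0, 0)"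
        by simp
      then show ?thesis using n by simp
    qed
    moreover have "\<sigma> c = c" if "c \<in> K" for c
      using Klin[OF that, of "1\<^sub>m n"] n by (simp add: \<sigma>_def one)
    ultimately show ?thesis by (simp add: gal_def)
  qed
  note expand = semilinear_expansion[of n \<phi>, OF car add zero smult]
  \<comment> \<open>A nonzero entry of the image of \<open>?E 0 0\<close> selects the column
    \<open>b0\<close> used for P and the row \<open>a0\<close> used for Q; its inverse normalises
    Q.\<close>
  have "?E 0 0 \<noteq> 0\<^sub>m n n" using n by (auto simp: mat_eq_iff)
  then have "\<phi> (?E 0 0) \<noteq> 0\<^sub>m n n" using ker by auto
  then obtain a0 b0 where ab: "a0 < n" "b0 < n" "\<phi> (?E 0 0) $$ (a0, b0) \<noteq> 0"
    using car[of "?E 0 0"] by (auto simp: mat_eq_iff)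
  \<comment> \<open>The columns of \<open>P\<close> are a common column of the images of the matrix units \<open>E\<^sub>b\<^sub>0\<close>; a row of the
    images of the \<open>E\<^sub>0\<^sub>i\<close> gives its inverse.\<close>
  define P where "P = mat n n (\<lambda>(a, b). \<phi> (?E b 0) $$ (a, b0))"
  define Q where "Q = mat n n (\<lambda>(i, j). inverse (\<phi> (?E 0 0) $$ (a0, b0)) * \<phi> (?E 0 i) $$ (a0, j))"
  have Pij: "P $$ (a, b) = \<phi> (?E b 0) $$ (a, b0)" if "a < n" "b < n" for a b
    using that by (simp add: P_def)
  have PC: "P \<in> carrier_mat n n" and QC: "Q \<in> carrier_mat n n" by (simp_all add: P_def Q_def)
  have "Q * P = 1\<^sub>m n"
  proof (rule eq_matI)
    fix i j assume "i < dim_row (1\<^sub>m n :: 'f mat)" "j < dim_col (1\<^sub>m n :: 'f mat)"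
    then have ij: "i < n" "j < n" by auto
    \<comment> \<open>The sum is an entry of a product of two images, so the multiplication rule of
      matrix units reduces it to the entry (a0, b0) of \<phi> (\<open>?E 0 0\<close>) if i = j and
      to 0 otherwise.\<close>
    have "(Q * P) $$ (i, j) = inverse (\<phi> (?E 0 0) $$ (a0, b0)) * (\<Sum>l<n. \<phi> (?E 0 i) $$ (a0, l) * \<phi> (?E j 0) $$ (l, b0))"
      unfolding mult_mat_index[OF QC PC ij] using ij
      by (simp add: P_def Q_def sum_distrib_left mult.assoc)
    also have "(\<Sum>l<n. \<phi> (?E 0 i) $$ (a0, l) * \<phi> (?E j 0) $$ (l, b0)) = \<phi> (?E 0 i * ?E j 0) $$ (a0, b0)"
      using ab by (subst mult) (simp_all add: mult_mat_index[OF car car])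
    also have "?E 0 i * ?E j 0 = (if i = j then ?E 0 0 else 0\<^sub>m n n)"
      using ij by (intro eq_matI) (auto simp: mult_unit_mat_at_index[of _ n] simp del: index_mult_mat(1))
    finally show "(Q * P) $$ (i, j) = 1\<^sub>m n $$ (i, j)" using ij ab by (simp add: zero)
  qed (use PC QC in auto)
  then have PGL: "P \<in> GL n" by (rule GL_I[OF PC QC])
  have "\<phi> X * P = P * map_mat \<sigma> X" if X: "X \<in> carrier_mat n n" for X
  proof (rule eq_matI)
    fix a b assume "a < dim_row (P * map_mat \<sigma> X)" "b < dim_col (P * map_mat \<sigma> X)"
    then have i: "a < n" "b < n" using PC X by auto
    have s0: "\<sigma> 0 = 0" using \<sigma>gal K by (auto simp: gal_def is_subfield_def)
    \<comment> \<open>Column b of P is column \<open>b0\<close> of \<phi> (\<open>?E b 0\<close>),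
      so X can be absorbed into the argument of \<phi>. In \<open>X * ?E b 0\<close> only column 0
      survives, and it is column b of X.\<close>
    have "(\<phi> X * P) $$ (a, b) = (\<phi> X * \<phi> (?E b 0)) $$ (a, b0)"
      using i ab by (simp add: mult_mat_index[OF car[OF X] PC] mult_mat_index[OF car[OF X] car] Pij)
    also have "\<dots> = \<phi> (X * ?E b 0) $$ (a, b0)" using X by (simp add: mult)
    also have "\<dots> = (\<Sum>l<n. \<Sum>r<n. \<sigma> ((X * ?E b 0) $$ (l, r)) * \<phi> (?E l r) $$ (a, b0))"
      by (rule expand) (use X i ab in auto)
    also have "\<dots> = (\<Sum>l<n. \<Sum>r<n. if r = 0 then \<sigma> (X $$ (l, b)) * \<phi> (?E l 0) $$ (a, b0) else 0)"
      using X i by (intro sum.cong) (auto simp: mult_unit_mat_at_index s0 simp del: index_mult_mat(1))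
    also have "\<dots> = (\<Sum>l<n. \<sigma> (X $$ (l, b)) * \<phi> (?E l 0) $$ (a, b0))"
      using n by simp
    also have "\<dots> = (P * map_mat \<sigma> X) $$ (a, b)"
      using X i PC by (subst mult_mat_index[of _ n]) (auto simp: P_def mult.commute intro!: sum.cong)
    finally show "(\<phi> X * P) $$ (a, b) = (P * map_mat \<sigma> X) $$ (a, b)" .
  qed (use PC X car[OF X] in auto)
  with \<sigma>gal PGL show thesis by (rule that)
qed

section \<open>Tuples with equal relations\<close>

definition relations :: "nat \<Rightarrow> nat \<Rightarrow> 'f::field set \<Rightarrow> 'f mat list \<Rightarrow> ('f \<times> nat list) list set" where
  "relations k n K h = {L \<in> valid k K. ev n h L = 0\<^sub>m n n}"

lemma Gen_MatD:
  assumes "is_subfield K" "h \<in> Gen_Mat k n K"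
  shows "h \<in> pow_carrier k n" "X \<in> carrier_mat n n \<Longrightarrow> \<exists>L\<in>valid k K. ev n h L = X"
  using assms by (auto simp: Gen_Mat_iff)

text \<open>Because h generates A, evaluating the relations of h' at h gives a two-sided ideal of A.
  The extra relation makes it nonzero, so by simplicity it contains the identity.\<close>

lemma extra_relation_separates:
  assumes K: "is_subfield K" and h: "h \<in> Gen_Mat k n K" "h' \<in> Gen_Mat k n K"
    and L: "L \<in> relations k n K h'" "L \<notin> relations k n K h"
  shows "\<exists>L\<in>valid k K. ev n h L = 1\<^sub>m n \<and> ev n h' L = 0\<^sub>m n n"
proof -
  note hc = Gen_MatD(1)[OF K h(1)] Gen_MatD(1)[OF K h(2)]
  note car = ev_carrier[OF K hc(1)] ev_carrier[OF K hc(2)]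
  define I where "I = ev n h ` relations k n K h'"
  have "1\<^sub>m n \<in> I"
  proof (rule matrix_ideal_contains_one)
    show "X + Y \<in> I" if XY: "X \<in> I" "Y \<in> I" for X Y
    proof -
      obtain M N where "M \<in> relations k n K h'" "N \<in> relations k n K h'" "X = ev n h M" "Y = ev n h N"
        using XY unfolding I_def by blast
      then show ?thesis unfolding I_def
        by (intro image_eqI[where x="M @ N"])
          (auto simp: relations_def ev_append[OF K hc(1)] ev_append[OF K hc(2)])
    qed
    show "X * Y \<in> I" if X: "X \<in> carrier_mat n n" and Y: "Y \<in> I" for X Y
    proof -
      obtain M where M: "M \<in> relations k n K h'" "Y = ev n h M" using Y by (auto simp: I_def)
      obtain N where N: "N \<in> valid k K" "ev n h N = X" using Gen_MatD(2)[OF K h(1) X] by auto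
      have "ev n h' N * 0\<^sub>m n n = 0\<^sub>m n n" using car(2)[OF N(1)] by simp
      then show ?thesis using M N unfolding I_def
        by (intro image_eqI[where x="times_comb N M"])
          (auto simp: relations_def ev_times_comb[OF K hc(1)] ev_times_comb[OF K hc(2)]
            times_comb_valid[OF K hc(1)])
    qed
    show "Y * X \<in> I" if Y: "Y \<in> I" and X: "X \<in> carrier_mat n n" for X Y
    proof -
      obtain M where M: "M \<in> relations k n K h'" "Y = ev n h M" using Y by (auto simp: I_def)
      obtain N where N: "N \<in> valid k K" "ev n h N = X" using Gen_MatD(2)[OF K h(1) X] by auto
      have "0\<^sub>m n n * ev n h' N = 0\<^sub>m n n" using car(2)[OF N(1)] by simp
      then show ?thesis using M N unfolding I_def
        by (intro image_eqI[where x="times_comb M N"])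
          (auto simp: relations_def ev_times_comb[OF K hc(1)] ev_times_comb[OF K hc(2)]
            times_comb_valid[OF K hc(1)])
    qed
    show "ev n h L \<in> I" using L by (simp add: I_def)
    show "ev n h L \<in> carrier_mat n n" "ev n h L \<noteq> 0\<^sub>m n n"
      using L car(1) by (auto simp: relations_def)
  qed
  then show ?thesis by (auto simp: I_def relations_def)
qed

text \<open>If the surplus relation lies on the side of h, exchanging the roles gives M with value 0
  at h and 1 at h', and 1 - M has the required values.\<close>

lemma distinct_relations_separate:
  assumes K: "is_subfield K" and h: "h \<in> Gen_Mat k n K" "h' \<in> Gen_Mat k n K"
    and ne: "relations k n K h \<noteq> relations k n K h'"
  shows "\<exists>L\<in>valid k K. ev n h L = 1\<^sub>m n \<and> ev n h' L = 0\<^sub>m n n"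
proof (cases "relations k n K h' \<subseteq> relations k n K h")
  case False
  then show ?thesis using extra_relation_separates[OF K h] by auto
next
  case True
  note hc = Gen_MatD(1)[OF K h(1)] Gen_MatD(1)[OF K h(2)]
  obtain L where "L \<in> relations k n K h" "L \<notin> relations k n K h'" using True ne by auto
  from extra_relation_separates[OF K h(2,1) this] obtain M where
    M: "M \<in> valid k K" "ev n h' M = 1\<^sub>m n" "ev n h M = 0\<^sub>m n n" by auto
  have "1\<^sub>m n - 0\<^sub>m n n = (1\<^sub>m n :: 'a mat)" "1\<^sub>m n - 1\<^sub>m n = (0\<^sub>m n n :: 'a mat)"
    by (auto intro!: eq_matI)
  then show ?thesis using M one_comb_valid[OF K hc(1)]
    by (intro bexI[of _ "minus_comb [(1, [])] M"])
      (simp_all only: ev_minus_comb[OF K hc(1)] ev_minus_comb[OF K hc(2)]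
        minus_comb_valid[OF K hc(1)] ev_one_comb[OF K hc(1)] ev_one_comb[OF K hc(2)])
qed

text \<open>The Chinese remainder argument. Products of pairwise separators give combinations with
  value 1 in one component and 0 in all others, which allow the components to be prescribed
  independently.\<close>

lemma joint_Gen_eq:
  assumes K: "is_subfield K" and n: "n > 0"
  shows "joint_Gen k m n K =
    {hs. length hs = m \<and> set hs \<subseteq> Gen_Mat k n K \<and> distinct (map (relations k n K) hs)}"
proof (intro equalityI subsetI)
  fix hs assume hs: "hs \<in> joint_Gen k m n K"
  then have len: "length hs = m" and sub: "set hs \<subseteq> pow_carrier k n"
    and sol: "\<And>X. X \<in> pow_carrier m n \<Longrightarrow> \<exists>L\<in>valid k K. \<forall>j<m. ev n (hs ! j) L = X ! j"
    by (auto simp: joint_Gen_def)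
  have "hs ! j \<in> Gen_Mat k n K" if j: "j < m" for j
  proof -
    have "\<exists>L\<in>valid k K. ev n (hs ! j) L = X" if "X \<in> carrier_mat n n" for X
      using sol[of "replicate m X"] that j by (auto simp: pow_carrier_def)
    then show ?thesis using sub j len by (auto simp: Gen_Mat_iff[OF K])
  qed
  then have "set hs \<subseteq> Gen_Mat k n K" using len by (auto simp: in_set_conv_nth)
  moreover have "relations k n K (hs ! i) \<noteq> relations k n K (hs ! j)" if "i < m" "j < m" "i \<noteq> j" for i j
  proof
    assume eq: "relations k n K (hs ! i) = relations k n K (hs ! j)"
    \<comment> \<open>A combination with value 1 in component i and 0 elsewhere is a relation of
      \<open>hs ! j\<close> but not of \<open>hs ! i\<close>, as 1 and 0 differ for n > 0.\<close>
    have "(replicate m (0\<^sub>m n n))[i := 1\<^sub>m n] \<in> pow_carrier m n"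
      using set_update_subset_insert[of "replicate m (0\<^sub>m n n)" i "1\<^sub>m n"]
      by (auto simp: pow_carrier_def split: if_splits)
    from sol[OF this] obtain L where L: "L \<in> valid k K"
      "\<forall>l<m. ev n (hs ! l) L = (replicate m (0\<^sub>m n n))[i := 1\<^sub>m n] ! l" by auto
    then have "ev n (hs ! i) L = 1\<^sub>m n" "ev n (hs ! j) L = 0\<^sub>m n n" using that by auto
    moreover from this have "L \<in> relations k n K (hs ! i)" using eq L(1) by (simp add: relations_def)
    then have "ev n (hs ! i) L = 0\<^sub>m n n" by (simp add: relations_def)
    ultimately have "(1\<^sub>m n :: 'a mat) $$ (0, 0) = 0\<^sub>m n n $$ (0, 0)" by simp
    then show False using n by simp
  qed
  ultimately show "hs \<in> {hs. length hs = m \<and> set hs \<subseteq> Gen_Mat k n K \<and> distinct (map (relations k n K) hs)}"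
    using len by (auto simp: distinct_conv_nth)
next
  fix hs assume "hs \<in> {hs. length hs = m \<and> set hs \<subseteq> Gen_Mat k n K \<and> distinct (map (relations k n K) hs)}"
  then have len: "length hs = m" and sub: "set hs \<subseteq> Gen_Mat k n K"
    and dist: "distinct (map (relations k n K) hs)" by auto
  have gen: "hs ! j \<in> Gen_Mat k n K" if "j < m" for j using that sub len by auto
  have pc: "hs ! j \<in> pow_carrier k n" if "j < m" for j by (rule Gen_MatD(1)[OF K gen[OF that]])
  have sep: "\<exists>L\<in>valid k K. ev n (hs ! i) L = 1\<^sub>m n \<and> ev n (hs ! j) L = 0\<^sub>m n n"
    if "i < m" "j < m" "i \<noteq> j" for i j
    using dist that len by (intro distinct_relations_separate[OF K gen gen]) (auto simp: distinct_conv_nth)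
  \<comment> \<open>Each induction step multiplies by one more separator: value 1 in component i is
    kept, and the components already annihilated stay 0.\<close>
  have idem: "\<exists>L\<in>valid k K. ev n (hs ! i) L = 1\<^sub>m n \<and> (\<forall>j<t. j \<noteq> i \<longrightarrow> ev n (hs ! j) L = 0\<^sub>m n n)"
    if i: "i < m" and "t \<le> m" for i t
    using \<open>t \<le> m\<close>
  proof (induction t)
    case 0
    show ?case using one_comb_valid[OF K pc[OF i]] ev_one_comb[OF K pc[OF i]] by blast
  next
    case (Suc t)
    then obtain L where L: "L \<in> valid k K" "ev n (hs ! i) L = 1\<^sub>m n"
      "\<And>j. j < t \<Longrightarrow> j \<noteq> i \<Longrightarrow> ev n (hs ! j) L = 0\<^sub>m n n" by auto
    show ?case
    proof (cases "t = i")
      case True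
      then show ?thesis using L by (auto simp: less_Suc_eq)
    next
      case False
      then obtain M where M: "M \<in> valid k K" "ev n (hs ! i) M = 1\<^sub>m n" "ev n (hs ! t) M = 0\<^sub>m n n"
        using sep[OF i, of t] Suc.prems by auto
      have "ev n (hs ! j) (times_comb L M) = 0\<^sub>m n n" if "j < Suc t" "j \<noteq> i" for j
      proof -
        have j: "j < m" using that Suc.prems by simp
        have "ev n (hs ! j) (times_comb L M) = ev n (hs ! j) L * ev n (hs ! j) M"
          by (rule ev_times_comb[OF K pc[OF j] L(1) M(1)])
        moreover have "ev n (hs ! j) L = 0\<^sub>m n n \<or> ev n (hs ! j) M = 0\<^sub>m n n"
          using that L(3) M(3) by (auto simp: less_Suc_eq)
        ultimately show ?thesis
          using ev_carrier[OF K pc[OF j] L(1)] ev_carrier[OF K pc[OF j] M(1)] by auto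
      qed
      moreover have "ev n (hs ! i) (times_comb L M) = 1\<^sub>m n"
        using ev_times_comb[OF K pc[OF i] L(1) M(1)] L(2) M(2) by simp
      ultimately show ?thesis using times_comb_valid[OF K pc[OF i] L(1) M(1)] by blast
    qed
  qed
  have "\<exists>L\<in>valid k K. \<forall>j<m. ev n (hs ! j) L = X ! j" if X: "X \<in> pow_carrier m n" for X
  proof -
    have XC: "X ! j \<in> carrier_mat n n" if "j < m" for j using X that by (auto simp: pow_carrier_def)
    \<comment> \<open>Components are corrected one at a time: the summand
      \<open>times_comb M U\<close> has value \<open>X ! t\<close> in component t and 0 in every
      other one.\<close>
    have "\<exists>L\<in>valid k K. \<forall>j<m. ev n (hs ! j) L = (if j < t then X ! j else 0\<^sub>m n n)" if "t \<le> m" for t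
      using that
    proof (induction t)
      case 0
      then show ?case by (intro bexI[of _ "[]"]) auto
    next
      case (Suc t)
      then obtain L where L: "L \<in> valid k K"
        "\<And>j. j < m \<Longrightarrow> ev n (hs ! j) L = (if j < t then X ! j else 0\<^sub>m n n)" by auto
      have t: "t < m" using Suc.prems by simp
      obtain U where U: "U \<in> valid k K" "ev n (hs ! t) U = 1\<^sub>m n"
        "\<And>j. j < m \<Longrightarrow> j \<noteq> t \<Longrightarrow> ev n (hs ! j) U = 0\<^sub>m n n" using idem[OF t order_refl] by auto
      obtain M where M: "M \<in> valid k K" "ev n (hs ! t) M = X ! t"
        using Gen_MatD(2)[OF K gen[OF t] XC[OF t]] by auto
      have MU: "times_comb M U \<in> valid k K" by (rule times_comb_valid[OF K pc[OF t] M(1) U(1)])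
      have "ev n (hs ! j) (L @ times_comb M U) = (if j < Suc t then X ! j else 0\<^sub>m n n)" if j: "j < m" for j
      proof -
        have "ev n (hs ! j) (L @ times_comb M U) = ev n (hs ! j) L + ev n (hs ! j) M * ev n (hs ! j) U"
          by (simp add: ev_append[OF K pc[OF j] L(1) MU] ev_times_comb[OF K pc[OF j] M(1) U(1)])
        then show ?thesis
          using L(2)[OF j] U(2) U(3)[OF j] M(2) XC[OF j] ev_carrier[OF K pc[OF j] M(1)]
          by (cases "j = t") auto
      qed
      then show ?case using L(1) MU by (intro bexI[of _ "L @ times_comb M U"]) auto
    qed
    from this[of m] show ?thesis by auto
  qed
  then show "hs \<in> joint_Gen k m n K"
    using len sub Gen_MatD(1)[OF K] by (auto simp: joint_Gen_def)
qed

section \<open>Automorphisms match the generating tuples with equal relations\<close>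

definition alg_aut :: "'f::field set \<Rightarrow> nat \<Rightarrow> ('f mat \<Rightarrow> 'f mat) \<Rightarrow> bool" where
  "alg_aut K n \<phi> \<longleftrightarrow> alg_hom K n \<phi> \<and>
     (\<forall>Y\<in>carrier_mat n n. \<exists>X\<in>carrier_mat n n. \<phi> X = Y) \<and>
     (\<forall>X\<in>carrier_mat n n. \<phi> X = 0\<^sub>m n n \<longrightarrow> X = 0\<^sub>m n n)"

lemma alg_aut_preserves:
  assumes K: "is_subfield K" and \<phi>: "alg_aut K n \<phi>" and h: "h \<in> Gen_Mat k n K"
  shows "map \<phi> h \<in> Gen_Mat k n K" "relations k n K (map \<phi> h) = relations k n K h"
proof -
  have hom: "alg_hom K n \<phi>" using \<phi> by (simp add: alg_aut_def)
  note hc = Gen_MatD(1)[OF K h]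
  note ev = ev_map_alg_hom[OF K hc hom]
  have "\<exists>L\<in>valid k K. ev n (map \<phi> h) L = Y" if Y: "Y \<in> carrier_mat n n" for Y
  proof -
    obtain X where "X \<in> carrier_mat n n" "\<phi> X = Y" using \<phi> Y unfolding alg_aut_def by blast
    then show ?thesis using Gen_MatD(2)[OF K h, of X] ev by auto
  qed
  then show "map \<phi> h \<in> Gen_Mat k n K"
    using map_alg_hom_pow_carrier[OF K hc hom] by (simp add: Gen_Mat_iff[OF K])
  have "\<phi> (ev n h L) = 0\<^sub>m n n \<longleftrightarrow> ev n h L = 0\<^sub>m n n" if "L \<in> valid k K" for L
    using \<phi> ev_carrier[OF K hc that] alg_hom_zero[OF K hom] by (auto simp: alg_aut_def)
  then show "relations k n K (map \<phi> h) = relations k n K h"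
    by (auto simp: relations_def ev alg_hom_zero[OF K hom])
qed

text \<open>The automorphism sends the value of L at h to the value of L at h'. It is well defined
  and has trivial kernel since the two tuples have the same relations, and it is surjective since h'
  generates. One-letter words show that it carries h to h'.\<close>

lemma same_relations_alg_aut:
  assumes K: "is_subfield K" and h: "h \<in> Gen_Mat k n K" "h' \<in> Gen_Mat k n K"
    and eq: "relations k n K h = relations k n K h'"
  obtains \<phi> where "alg_aut K n \<phi>" "h' = map \<phi> h"
proof -
  note hc = Gen_MatD(1)[OF K h(1)] Gen_MatD(1)[OF K h(2)]
  note ops = ev_append[OF K hc(1)] ev_append[OF K hc(2)]
    ev_times_comb[OF K hc(1)] ev_times_comb[OF K hc(2)]
    ev_scale_left[OF K hc(1)] ev_scale_left[OF K hc(2)]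
  have diff0: "X - Y = 0\<^sub>m n n \<longleftrightarrow> X = Y" if "X \<in> carrier_mat n n" "Y \<in> carrier_mat n n" for X Y :: "'a mat"
    using that by (auto simp: mat_eq_iff)
  have wd: "ev n h L = ev n h M \<longleftrightarrow> ev n h' L = ev n h' M" if LM: "L \<in> valid k K" "M \<in> valid k K" for L M
  proof -
    have "minus_comb L M \<in> relations k n K h \<longleftrightarrow> minus_comb L M \<in> relations k n K h'" by (simp add: eq)
    then show ?thesis
      using minus_comb_valid[OF K hc(1) LM] ev_minus_comb[OF K hc(1) LM] ev_minus_comb[OF K hc(2) LM]
        diff0[OF ev_carrier[OF K hc(1) LM(1)] ev_carrier[OF K hc(1) LM(2)]]
        diff0[OF ev_carrier[OF K hc(2) LM(1)] ev_carrier[OF K hc(2) LM(2)]]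
      by (simp add: relations_def)
  qed
  \<comment> \<open>The representative is arbitrary; by \<open>wd\<close> the value does not depend
    on it.\<close>
  define \<phi> where "\<phi> = (\<lambda>X. ev n h' (SOME L. L \<in> valid k K \<and> ev n h L = X))"
  have \<phi>: "\<phi> (ev n h L) = ev n h' L" if L: "L \<in> valid k K" for L
  proof -
    define M where "M = (SOME M. M \<in> valid k K \<and> ev n h M = ev n h L)"
    have "M \<in> valid k K \<and> ev n h M = ev n h L"
      unfolding M_def by (rule someI[of _ L]) (simp add: L)
    then show ?thesis using wd[of M L] L by (simp add: \<phi>_def M_def)
  qed
  have rep: "\<exists>L. L \<in> valid k K \<and> X = ev n h L" if "X \<in> carrier_mat n n" for X
    using Gen_MatD(2)[OF K h(1) that] by auto
  have "alg_hom K n \<phi>"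
    unfolding alg_hom_def
  proof (intro conjI ballI)
    show "\<phi> X \<in> carrier_mat n n" if "X \<in> carrier_mat n n" for X
      using rep[OF that] \<phi> ev_carrier[OF K hc(2)] by auto
    show "\<phi> (1\<^sub>m n) = 1\<^sub>m n"
      using \<phi>[OF one_comb_valid[OF K hc(1)]] ev_one_comb[OF K hc(1)] ev_one_comb[OF K hc(2)] by metis
    fix X :: "'a mat" assume "X \<in> carrier_mat n n"
    then obtain L where L: "L \<in> valid k K" "X = ev n h L" using rep by auto
    show "\<phi> (c \<cdot>\<^sub>m X) = c \<cdot>\<^sub>m \<phi> X" if "c \<in> K" for c
      using \<phi>[OF scale_left_valid[OF K hc(1) that _ L(1), of "[]"]] L
        ev_carrier[OF K hc(1) L(1)] ev_carrier[OF K hc(2) L(1)]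
      by (simp add: ops \<phi>)
    fix Y :: "'a mat" assume "Y \<in> carrier_mat n n"
    then obtain M where M: "M \<in> valid k K" "Y = ev n h M" using rep by auto
    show "\<phi> (X + Y) = \<phi> X + \<phi> Y" using \<phi>[of "L @ M"] L M by (simp add: ops \<phi>)
    show "\<phi> (X * Y) = \<phi> X * \<phi> Y"
      using \<phi>[OF times_comb_valid[OF K hc(1) L(1) M(1)]] L M by (simp add: ops \<phi>)
  qed
  moreover have "\<exists>X\<in>carrier_mat n n. \<phi> X = Y" if "Y \<in> carrier_mat n n" for Y
    using Gen_MatD(2)[OF K h(2) that] \<phi> ev_carrier[OF K hc(1)] by metis
  moreover have "X = 0\<^sub>m n n" if X: "X \<in> carrier_mat n n" "\<phi> X = 0\<^sub>m n n" for X
  proof -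
    obtain L where L: "L \<in> valid k K" "X = ev n h L" using rep[OF X(1)] by auto
    then show ?thesis using X(2) \<phi> eq by (auto simp: relations_def)
  qed
  ultimately have "alg_aut K n \<phi>" by (auto simp: alg_aut_def)
  moreover have "h' = map \<phi> h"
  proof (rule nth_equalityI)
    show len: "length h' = length (map \<phi> h)" using hc by (simp add: pow_carrier_def)
    fix i assume "i < length h'"
    then have i: "i < k" "i < length h" using hc by (simp_all add: pow_carrier_def)
    have "[(1, [i])] \<in> valid k K" using K i by (simp add: is_subfield_def)
    from \<phi>[OF this] show "h' ! i = map \<phi> h ! i"
      using ev_generator[OF K hc(1) i(1)] ev_generator[OF K hc(2) i(1)] i(2) by (simp del: ev_Cons)
  qed
  ultimately show thesis by (rule that)
qed

section \<open>Finiteness of the sets to be counted\<close>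

lemma finite_carrier_mat: "finite (carrier_mat n m :: 'f::finite mat set)"
proof -
  have "carrier_mat n m \<subseteq> (\<lambda>f. mat n m f) ` (({..<n} \<times> {..<m}) \<rightarrow>\<^sub>E (UNIV :: 'f set))"
  proof
    fix X :: "'f mat" assume X: "X \<in> carrier_mat n m"
    show "X \<in> (\<lambda>f. mat n m f) ` (({..<n} \<times> {..<m}) \<rightarrow>\<^sub>E UNIV)"
      by (rule image_eqI[where x="restrict (\<lambda>ij. X $$ ij) ({..<n} \<times> {..<m})"])
        (use X in \<open>auto intro!: eq_matI\<close>)
  qed
  then show ?thesis by (rule finite_subset) (simp add: finite_PiE)
qed

lemma finite_pow_carrier: "finite (pow_carrier m n :: 'f::{finite,field} mat list set)"
proof -
  have "pow_carrier m n = {xs. set xs \<subseteq> (carrier_mat n n :: 'f mat set) \<and> length xs = m}"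
    by (auto simp: pow_carrier_def)
  then show ?thesis using finite_lists_length_eq[OF finite_carrier_mat] by simp
qed

lemma finite_Gen_Mat: "finite (Gen_Mat k n (K :: 'f::{finite,field} set))"
  by (rule finite_subset[OF _ finite_pow_carrier[of k n]])
    (auto simp: Gen_Mat_def Gen_def pow_carrier_def)

lemma finite_Gen_Pow: "finite (Gen_Pow k m n (K :: 'f::{finite,field} set))"
  by (rule finite_subset[OF _ finite_lists_length_eq[OF finite_pow_carrier[of m n], of k]])
    (auto simp: Gen_Pow_def Gen_def)

text \<open>Q stands for the inverse of P and is carried as an argument, so that no inverse has to
  be chosen inside the formula.\<close>

definition twisted_conj :: "('f::field \<Rightarrow> 'f) \<Rightarrow> 'f mat \<Rightarrow> 'f mat \<Rightarrow> 'f mat \<Rightarrow> 'f mat" where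
  "twisted_conj \<sigma> P Q X = P * map_mat \<sigma> X * Q"

context
  fixes K :: "'f::{finite,field} set" and n :: nat and \<sigma> :: "'f \<Rightarrow> 'f" and P Q :: "'f mat"
  assumes K: "is_subfield K" and \<sigma>: "\<sigma> \<in> gal K"
    and P: "P \<in> carrier_mat n n" and Q: "Q \<in> carrier_mat n n"
    and PQ: "P * Q = 1\<^sub>m n" and QP: "Q * P = 1\<^sub>m n"
begin

lemma twisted_conj_cancel:
  assumes "X \<in> carrier_mat n n"
  shows "Q * twisted_conj \<sigma> P Q X * P = map_mat \<sigma> X"
proof -
  note [simp] = P Q assms
  have [simp]: "map_mat \<sigma> X \<in> carrier_mat n n" by simp
  have "Q * twisted_conj \<sigma> P Q X * P = (Q * P) * map_mat \<sigma> X * (Q * P)"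
    unfolding twisted_conj_def
    by (simp add: assoc_mult_mat[of _ n n _ n _ n] mult_carrier_mat[of _ n n _ n])
  then show ?thesis by (simp add: QP left_mult_one_mat[of _ n n] right_mult_one_mat[of _ n n])
qed

lemma twisted_conj_alg_aut: "alg_aut K n (twisted_conj \<sigma> P Q)"
proof -
  interpret S: comm_ring_hom \<sigma> by (rule gal_comm_ring_hom[OF K \<sigma>])
  have Kfix: "\<And>c. c \<in> K \<Longrightarrow> \<sigma> c = c" using \<sigma> by (simp add: gal_def)
  note [simp] = P Q mult_carrier_mat[of _ n n _ n]
  have add: "map_mat \<sigma> (X + Y) = map_mat \<sigma> X + map_mat \<sigma> Y"
    if "X \<in> carrier_mat n n" "Y \<in> carrier_mat n n" for X Y
    using that by (intro eq_matI) (auto simp: S.hom_add)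
  have smult: "map_mat \<sigma> (c \<cdot>\<^sub>m X) = \<sigma> c \<cdot>\<^sub>m map_mat \<sigma> X" if "X \<in> carrier_mat n n" for c X
    using that by (intro eq_matI) (auto simp: S.hom_mult)
  have "twisted_conj \<sigma> P Q (X + Y) = twisted_conj \<sigma> P Q X + twisted_conj \<sigma> P Q Y"
    if "X \<in> carrier_mat n n" "Y \<in> carrier_mat n n" for X Y
    using that by (simp add: twisted_conj_def add mult_add_distrib_mat[of _ n n _ n]
        add_mult_distrib_mat[of _ n n _ _ n])
  moreover have "twisted_conj \<sigma> P Q (X * Y) = twisted_conj \<sigma> P Q X * twisted_conj \<sigma> P Q Y"
    if XY: "X \<in> carrier_mat n n" "Y \<in> carrier_mat n n" for X Y
  proof -
    have c: "map_mat \<sigma> X \<in> carrier_mat n n" "map_mat \<sigma> Y \<in> carrier_mat n n" using XY by auto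
    have "twisted_conj \<sigma> P Q X * twisted_conj \<sigma> P Q Y
        = P * map_mat \<sigma> X * ((Q * P) * (map_mat \<sigma> Y * Q))"
      using c unfolding twisted_conj_def by (simp add: assoc_mult_mat[of _ n n _ n _ n])
    also have "\<dots> = P * (map_mat \<sigma> X * map_mat \<sigma> Y) * Q"
      using c unfolding QP by (simp add: assoc_mult_mat[of _ n n _ n _ n] left_mult_one_mat[of _ n n])
    finally show ?thesis using XY by (simp add: twisted_conj_def S.mat_hom_mult[of _ n n _ n])
  qed
  moreover have "twisted_conj \<sigma> P Q (1\<^sub>m n) = 1\<^sub>m n"
    by (simp add: twisted_conj_def S.mat_hom_one right_mult_one_mat[OF P] PQ)
  moreover have "twisted_conj \<sigma> P Q (c \<cdot>\<^sub>m X) = c \<cdot>\<^sub>m twisted_conj \<sigma> P Q X"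
    if "c \<in> K" "X \<in> carrier_mat n n" for c X
    using that by (simp add: twisted_conj_def smult Kfix mult_smult_distrib[of _ n n _ n]
        mult_smult_assoc_mat[of _ n n _ n])
  moreover have tc: "twisted_conj \<sigma> P Q X \<in> carrier_mat n n" if "X \<in> carrier_mat n n" for X
    using that by (simp add: twisted_conj_def)
  moreover have "\<exists>X\<in>carrier_mat n n. twisted_conj \<sigma> P Q X = Y" if Y: "Y \<in> carrier_mat n n" for Y
  proof -
    \<comment> \<open>The preimage of Y: undo the conjugation, then apply the inverse of \<sigma>
      entrywise.\<close>
    let ?Z = "Q * Y * P"
    have ZC: "?Z \<in> carrier_mat n n" using Y by simp
    have "map_mat \<sigma> (map_mat (inv_into UNIV \<sigma>) ?Z) = ?Z"
      using bij_is_surj[OF gal_bij[OF K \<sigma>]] by (intro eq_matI) (auto simp: surj_f_inv_f)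
    moreover have "P * ?Z * Q = (P * Q) * Y * (P * Q)"
      using Y by (simp add: assoc_mult_mat[of _ n n _ n _ n])
    ultimately have "twisted_conj \<sigma> P Q (map_mat (inv_into UNIV \<sigma>) ?Z) = Y"
      using Y by (simp add: twisted_conj_def PQ left_mult_one_mat[OF Y] right_mult_one_mat[OF Y])
    then show ?thesis using ZC by (intro bexI[of _ "map_mat (inv_into UNIV \<sigma>) ?Z"]) auto
  qed
  moreover have "X = 0\<^sub>m n n" if X: "X \<in> carrier_mat n n" and 0: "twisted_conj \<sigma> P Q X = 0\<^sub>m n n" for X
  proof -
    have "map_mat \<sigma> X = 0\<^sub>m n n"
      using twisted_conj_cancel[OF X] right_mult_zero_mat[OF Q, of n] left_mult_zero_mat[OF P, of n]
      by (simp add: 0)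
    moreover have "\<sigma> x = 0 \<Longrightarrow> x = 0" for x
      using bij_is_inj[OF gal_bij[OF K \<sigma>]] S.hom_zero by (metis injD)
    ultimately show ?thesis using X by (auto simp: mat_eq_iff)
  qed
  ultimately show ?thesis unfolding alg_aut_def alg_hom_def by simp
qed

end

text \<open>Conjugation fixes scalar matrices, so these reveal \<sigma>. Matrix units have entries 0
  and 1 and are fixed by both field automorphisms, so Q' P commutes with all of them and is
  scalar.\<close>

lemma twisted_conj_eqD:
  fixes K :: "'f::{finite,field} set"
  assumes K: "is_subfield K" and n: "n > 0" and \<sigma>: "\<sigma> \<in> gal K" "\<sigma>' \<in> gal K"
    and P: "P \<in> carrier_mat n n" "Q \<in> carrier_mat n n" "P * Q = 1\<^sub>m n" "Q * P = 1\<^sub>m n"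
    and P': "P' \<in> carrier_mat n n" "Q' \<in> carrier_mat n n" "P' * Q' = 1\<^sub>m n" "Q' * P' = 1\<^sub>m n"
    and eq: "\<And>X. X \<in> carrier_mat n n \<Longrightarrow> twisted_conj \<sigma> P Q X = twisted_conj \<sigma>' P' Q' X"
  shows "\<sigma> = \<sigma>'" "\<exists>z. z \<noteq> 0 \<and> P = z \<cdot>\<^sub>m P'"
proof -
  note [simp] = P(1,2) P'(1,2) mult_carrier_mat[of _ n n _ n]
  have s: "twisted_conj \<tau> R S (c \<cdot>\<^sub>m 1\<^sub>m n) = \<tau> c \<cdot>\<^sub>m 1\<^sub>m n"
    if \<tau>: "\<tau> \<in> gal K" and R: "R \<in> carrier_mat n n" "S \<in> carrier_mat n n" "R * S = 1\<^sub>m n"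
    for \<tau> R S and c :: 'f
  proof -
    interpret T: comm_ring_hom \<tau> by (rule gal_comm_ring_hom[OF K \<tau>])
    have "map_mat \<tau> (c \<cdot>\<^sub>m 1\<^sub>m n) = \<tau> c \<cdot>\<^sub>m 1\<^sub>m n" by (intro eq_matI) auto
    then show ?thesis using R right_mult_one_mat[OF R(1)]
      by (simp add: twisted_conj_def mult_smult_distrib[of _ n n _ n] mult_smult_assoc_mat[of _ n n _ n])
  qed
  have "\<sigma> c \<cdot>\<^sub>m (1\<^sub>m n :: 'f mat) = \<sigma>' c \<cdot>\<^sub>m 1\<^sub>m n" for c
    using eq[of "c \<cdot>\<^sub>m 1\<^sub>m n"] s[OF \<sigma>(1) P(1,2,3)] s[OF \<sigma>(2) P'(1,2,3)] by simp
  then have "(\<sigma> c \<cdot>\<^sub>m (1\<^sub>m n :: 'f mat)) $$ (0, 0) = (\<sigma>' c \<cdot>\<^sub>m 1\<^sub>m n) $$ (0, 0)" for c by simp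
  then show "\<sigma> = \<sigma>'" using n by auto
  define Z where "Z = Q' * P"
  have ZC: "Z \<in> carrier_mat n n" by (simp add: Z_def)
  interpret S: comm_ring_hom \<sigma> by (rule gal_comm_ring_hom[OF K \<sigma>(1)])
  interpret S': comm_ring_hom \<sigma>' by (rule gal_comm_ring_hom[OF K \<sigma>(2)])
  have "Z * unit_mat_at n i j = unit_mat_at n i j * Z" for i j
  proof -
    let ?E = "unit_mat_at n i j :: 'f mat"
    have "map_mat \<sigma> ?E = ?E" "map_mat \<sigma>' ?E = ?E" by (intro eq_matI; auto)+
    then have e: "P * ?E * Q = P' * ?E * Q'" using eq[of ?E] by (simp add: twisted_conj_def)
    have "Z * ?E = Z * ?E * (Q * P)"
      using right_mult_one_mat[of "Z * ?E" n n] ZC by (simp add: P(4))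
    also have "\<dots> = Q' * (P * ?E * Q) * P"
      unfolding Z_def by (simp add: assoc_mult_mat[of _ n n _ n _ n])
    also have "\<dots> = (Q' * P') * ?E * (Q' * P)"
      unfolding e by (simp add: assoc_mult_mat[of _ n n _ n _ n])
    also have "\<dots> = ?E * Z" unfolding P'(4) Z_def by (simp add: left_mult_one_mat[of _ n n])
    finally show ?thesis .
  qed
  from central_mat_scalar[OF ZC this] obtain z where z: "Z = z \<cdot>\<^sub>m 1\<^sub>m n" by metis
  have "P = (P' * Q') * P" unfolding P'(3) by (simp add: left_mult_one_mat[of _ n n])
  also have "\<dots> = P' * Z" by (simp add: Z_def assoc_mult_mat[of _ n n _ n _ n])
  also have "\<dots> = z \<cdot>\<^sub>m P'"
    using right_mult_one_mat[OF P'(1)] by (simp add: z mult_smult_distrib[of _ n n _ n])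
  finally have Pz: "P = z \<cdot>\<^sub>m P'" .
  moreover have "z \<noteq> 0"
  proof
    assume "z = 0"
    then have "P = 0\<^sub>m n n" using Pz zero_smult_mat[OF P'(1)] by simp
    then have "(1\<^sub>m n :: 'f mat) = 0\<^sub>m n n" using P(3) left_mult_zero_mat[OF P(2), of n] by simp
    then have "(1\<^sub>m n :: 'f mat) $$ (0, 0) = 0\<^sub>m n n $$ (0, 0)" by simp
    then show False using n by simp
  qed
  ultimately show "\<exists>z. z \<noteq> 0 \<and> P = z \<cdot>\<^sub>m P'" by blast
qed

lemma scalar_class_eq:
  fixes P :: "'f::field mat"
  assumes "z \<noteq> 0" "P = z \<cdot>\<^sub>m P'"
  shows "{c \<cdot>\<^sub>m P | c. c \<noteq> 0} = {c \<cdot>\<^sub>m P' | c. c \<noteq> 0}"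
proof (intro equalityI subsetI)
  fix X assume "X \<in> {c \<cdot>\<^sub>m P | c. c \<noteq> 0}"
  then obtain c where "c \<noteq> 0" "X = c \<cdot>\<^sub>m P" by auto
  then show "X \<in> {c \<cdot>\<^sub>m P' | c. c \<noteq> 0}" using assms
    by (auto simp: smult_smult_mat intro!: exI[of _ "c * z"])
next
  fix X assume "X \<in> {c \<cdot>\<^sub>m P' | c. c \<noteq> 0}"
  then obtain c where "c \<noteq> 0" "X = c \<cdot>\<^sub>m P'" by auto
  then show "X \<in> {c \<cdot>\<^sub>m P | c. c \<noteq> 0}" using assms
    by (auto simp: smult_smult_mat intro!: exI[of _ "c / z"])
qed

text \<open>Each class of tuples is an orbit on which the automorphism group acts freely, and that
  group is parametrised by \<sigma> together with a scalar class of matrices.\<close>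

lemma card_same_relations:
  fixes K :: "'f::{finite,field} set"
  assumes K: "is_subfield K" and n: "n > 0" and h: "h \<in> Gen_Mat k n K"
  shows "card {y \<in> Gen_Mat k n K. relations k n K y = relations k n K h}
    = card (gal K) * card (PGL n :: 'f mat set set)"
proof -
  note hc = Gen_MatD(1)[OF K h]
  have "\<exists>P Q. P \<in> carrier_mat n n \<and> Q \<in> carrier_mat n n \<and> P * Q = 1\<^sub>m n \<and> Q * P = 1\<^sub>m n \<and>
      C = {c \<cdot>\<^sub>m P | c. c \<noteq> 0}" if C: "C \<in> PGL n" for C :: "'f mat set"
  proof -
    obtain P where P: "P \<in> GL n" "C = {c \<cdot>\<^sub>m P | c. c \<noteq> 0}" using C unfolding PGL_def by blast
    obtain Q where "Q \<in> carrier_mat n n" "P * Q = 1\<^sub>m n" "Q * P = 1\<^sub>m n" by (rule GL_inverse[OF P(1)])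
    then show ?thesis using P by (intro exI[of _ P] exI[of _ Q]) (simp add: GL_def)
  qed
  then have "\<forall>C\<in>PGL n. \<exists>PQ :: 'f mat \<times> 'f mat. fst PQ \<in> carrier_mat n n \<and> snd PQ \<in> carrier_mat n n \<and>
      fst PQ * snd PQ = 1\<^sub>m n \<and> snd PQ * fst PQ = 1\<^sub>m n \<and> C = {c \<cdot>\<^sub>m fst PQ | c. c \<noteq> 0}"
    by fastforce
  \<comment> \<open>One representative and its inverse are fixed for every scalar class, so that
    \<open>PGL n\<close> itself can index the bijection \<open>F\<close>.\<close>
  from bchoice[OF this] obtain g :: "'f mat set \<Rightarrow> 'f mat \<times> 'f mat" where
    g: "\<forall>C\<in>PGL n. fst (g C) \<in> carrier_mat n n \<and> snd (g C) \<in> carrier_mat n n \<and>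
      fst (g C) * snd (g C) = 1\<^sub>m n \<and> snd (g C) * fst (g C) = 1\<^sub>m n \<and>
      C = {c \<cdot>\<^sub>m fst (g C) | c. c \<noteq> 0}" ..
  define p where "p C = fst (g C)" for C
  define q where "q C = snd (g C)" for C
  have "p C \<in> carrier_mat n n \<and> q C \<in> carrier_mat n n \<and> p C * q C = 1\<^sub>m n \<and> q C * p C = 1\<^sub>m n \<and>
      C = {c \<cdot>\<^sub>m p C | c. c \<noteq> 0}" if "C \<in> PGL n" for C
    unfolding p_def q_def by (rule bspec[OF g that])
  note pq = this[THEN conjunct1] this[THEN conjunct2, THEN conjunct1]
    this[THEN conjunct2, THEN conjunct2, THEN conjunct1]
    this[THEN conjunct2, THEN conjunct2, THEN conjunct2, THEN conjunct1]
    this[THEN conjunct2, THEN conjunct2, THEN conjunct2, THEN conjunct2]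
  define F where "F = (\<lambda>(\<sigma>, C). map (twisted_conj \<sigma> (p C) (q C)) h)"
  have aut: "alg_aut K n (twisted_conj \<sigma> (p C) (q C))" if "\<sigma> \<in> gal K" "C \<in> PGL n" for \<sigma> C
    by (rule twisted_conj_alg_aut[OF K that(1) pq(1-4)[OF that(2)]])
  have "bij_betw F (gal K \<times> PGL n) {y \<in> Gen_Mat k n K. relations k n K y = relations k n K h}"
    unfolding bij_betw_def
  proof (intro conjI equalityI subsetI)
    show "inj_on F (gal K \<times> PGL n)"
    proof (rule inj_onI, clarify)
      fix \<sigma> C \<sigma>' C' assume \<sigma>: "\<sigma> \<in> gal K" "\<sigma>' \<in> gal K" and C: "C \<in> PGL n" "C' \<in> PGL n"
        and eq: "F (\<sigma>, C) = F (\<sigma>', C')"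
      \<comment> \<open>Two automorphisms with the same values on h agree on every matrix, because h
        generates A.\<close>
      have t: "twisted_conj \<sigma> (p C) (q C) X = twisted_conj \<sigma>' (p C') (q C') X"
        if X: "X \<in> carrier_mat n n" for X
      proof -
        obtain L where L: "L \<in> valid k K" "ev n h L = X" using Gen_MatD(2)[OF K h X] by auto
        have hom: "alg_hom K n (twisted_conj \<sigma> (p C) (q C))" "alg_hom K n (twisted_conj \<sigma>' (p C') (q C'))"
          using aut \<sigma> C by (auto simp: alg_aut_def)
        show ?thesis using ev_map_alg_hom[OF K hc hom(1) L(1)] ev_map_alg_hom[OF K hc hom(2) L(1)] eq L(2)
          by (simp add: F_def del: map_eq_conv)
      qed
      note e = twisted_conj_eqD[OF K n \<sigma> pq(1-4)[OF C(1)] pq(1-4)[OF C(2)] t]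
      from e(2) obtain z where "z \<noteq> 0" "p C = z \<cdot>\<^sub>m p C'" by auto
      then have "C = C'" using scalar_class_eq[of z "p C" "p C'"] pq(5)[OF C(1)] pq(5)[OF C(2)] by simp
      then show "\<sigma> = \<sigma>' \<and> C = C'" using e(1) by simp
    qed
  next
    fix y assume "y \<in> F ` (gal K \<times> PGL n)"
    then obtain \<sigma> C where "\<sigma> \<in> gal K" "C \<in> PGL n" "y = map (twisted_conj \<sigma> (p C) (q C)) h"
      by (auto simp: F_def)
    then show "y \<in> {y \<in> Gen_Mat k n K. relations k n K y = relations k n K h}"
      using alg_aut_preserves[OF K aut h] by simp
  next
    fix y assume "y \<in> {y \<in> Gen_Mat k n K. relations k n K y = relations k n K h}"
    then have y: "y \<in> Gen_Mat k n K" "relations k n K h = relations k n K y" by auto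
    obtain \<phi> where \<phi>: "alg_aut K n \<phi>" "y = map \<phi> h" by (rule same_relations_alg_aut[OF K h y])
    have hom: "alg_hom K n \<phi>" using \<phi> by (simp add: alg_aut_def)
    obtain \<sigma> P where \<sigma>: "\<sigma> \<in> gal K" and P: "P \<in> GL n"
      and SN: "\<And>X. X \<in> carrier_mat n n \<Longrightarrow> \<phi> X * P = P * map_mat \<sigma> X"
      by (rule semilinear_Skolem_Noether[OF K n hom]) (use \<phi> in \<open>auto simp: alg_aut_def\<close>)
    define C where "C = {c \<cdot>\<^sub>m P | c. c \<noteq> 0}"
    have C: "C \<in> PGL n" using P by (auto simp: PGL_def C_def)
    have "P \<in> C" unfolding C_def by (rule CollectI, rule exI[of _ 1]) (simp add: one_smult_mat)
    \<comment> \<open>Skolem--Noether yields some matrix of the class, not the chosen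
      representative; the scalar c between them occurs on both sides of the intertwining equation
      and cancels.\<close>
    then obtain c where c: "c \<noteq> 0" "P = c \<cdot>\<^sub>m p C" using pq(5)[OF C] by auto
    note [simp] = pq(1,2)[OF C] mult_carrier_mat[of _ n n _ n]
    have "\<phi> X = twisted_conj \<sigma> (p C) (q C) X" if X: "X \<in> carrier_mat n n" for X
    proof -
      have fX: "\<phi> X \<in> carrier_mat n n" using hom X by (simp add: alg_hom_def)
      have "c \<cdot>\<^sub>m (\<phi> X * p C) = c \<cdot>\<^sub>m (p C * map_mat \<sigma> X)"
        using SN[OF X] fX X
        by (simp add: c(2) mult_smult_distrib[of _ n n _ n] mult_smult_assoc_mat[of _ n n _ n])
      then have "inverse c \<cdot>\<^sub>m (c \<cdot>\<^sub>m (\<phi> X * p C)) = inverse c \<cdot>\<^sub>m (c \<cdot>\<^sub>m (p C * map_mat \<sigma> X))" by simp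
      then have *: "\<phi> X * p C = p C * map_mat \<sigma> X" using c(1) by (simp add: smult_smult_mat one_smult_mat)
      have "\<phi> X = \<phi> X * (p C * q C)" using pq(3)[OF C] right_mult_one_mat[OF fX] by simp
      also have "\<dots> = \<phi> X * p C * q C" using fX by (simp add: assoc_mult_mat[of _ n n _ n _ n])
      also have "\<dots> = twisted_conj \<sigma> (p C) (q C) X" by (simp add: * twisted_conj_def)
      finally show ?thesis .
    qed
    then have "y = F (\<sigma>, C)" using \<phi>(2) hc by (auto simp: F_def pow_carrier_def)
    then show "y \<in> F ` (gal K \<times> PGL n)" using \<sigma> C by blast
  qed
  from bij_betw_same_card[OF this] show ?thesis by (simp add: card_cartesian_product)
qed

section \<open>From the class size to the bound and the product\<close>

lemma card_multiple_of_fibre: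
  assumes "finite G" and "\<And>x. x \<in> G \<Longrightarrow> card {y \<in> G. f y = f x} = c"
  shows "card G = card (f ` G) * c"
proof -
  have "card G = (\<Sum>z\<in>f ` G. card {y \<in> G. f y = z})"
    using sum.image_gen[OF assms(1), of "\<lambda>_. 1::nat" f] by simp
  also have "\<dots> = (\<Sum>z\<in>f ` G. c)" using assms(2) by (intro sum.cong) auto
  finally show ?thesis by simp
qed

lemma card_PGL_pos: "card (PGL n :: 'f::{finite,field} mat set set) > 0"
proof -
  have "(1\<^sub>m n :: 'f mat) \<in> GL n" by (rule GL_I[of _ _ "1\<^sub>m n"]) auto
  moreover have "finite (GL n :: 'f mat set)"
    by (rule finite_subset[OF _ finite_carrier_mat[of n n]]) (auto simp: GL_def)
  ultimately show ?thesis by (auto simp: PGL_def card_gt_0_iff)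
qed

theorem mainTheorem10:
  fixes q n s k m :: nat and K :: "'f::{finite,field} set"
  assumes "prime_power q" and "n > 0" and "s > 0" and "k > 0" and "m > 0"
    and "card (UNIV :: 'f set) = q ^ s" and "is_subfield K" and "card K = q"
  shows "(Gen_Pow k m n K \<noteq> {} \<longleftrightarrow>
           real m \<le> real (card (Gen_Mat k n K)) / (real s * real (card (PGL n :: 'f mat set set))))
       \<and> int (card (Gen_Pow k m n K)) =
           (\<Prod>i<m. int (card (Gen_Mat k n K)) - int i * int s * int (card (PGL n :: 'f mat set set)))"
proof -
  note K = \<open>is_subfield K\<close>
  define c where "c = s * card (PGL n :: 'f mat set set)"
  define r where "r = card (relations k n K ` Gen_Mat k n K)"
  have cpos: "c > 0" using \<open>s > 0\<close> card_PGL_pos[of n, where 'f='f] by (simp add: c_def)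
  have "card (gal K) = s" using card_gal[OF K] assms by simp
  then have fib: "card {y \<in> Gen_Mat k n K. relations k n K y = relations k n K h} = c"
    if "h \<in> Gen_Mat k n K" for h
    using card_same_relations[OF K \<open>n > 0\<close> that] by (simp add: c_def)
  have prod: "int (card (Gen_Pow k m n K)) = (\<Prod>i<m. int (card (Gen_Mat k n K)) - int i * int c)"
    unfolding card_Gen_Pow[OF K] joint_Gen_eq[OF K \<open>n > 0\<close>]
    by (rule card_lists_distinct_map[OF finite_Gen_Mat fib])
  \<comment> \<open>The number of generating tuples is a multiple of the class size, so the quotient
    in the bound is exactly the integer r.\<close>
  have rc: "card (Gen_Mat k n K) = r * c"
    unfolding r_def by (rule card_multiple_of_fibre[OF finite_Gen_Mat fib])
  have "Gen_Pow k m n K \<noteq> {} \<longleftrightarrow> int (card (Gen_Pow k m n K)) \<noteq> 0"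
    using finite_Gen_Pow[of k m n K] by simp
  \<comment> \<open>The factor with index i equals (r - i) c with c > 0, so it vanishes only for i =
    r; such an index occurs below m iff r < m.\<close>
  also have "\<dots> \<longleftrightarrow> (\<forall>i<m. r \<noteq> i)"
    using cpos unfolding prod rc by (auto simp flip: of_nat_mult)
  also have "\<dots> \<longleftrightarrow> m \<le> r" by (meson leI le_antisym less_irrefl order_less_le_trans)
  also have "\<dots> \<longleftrightarrow> real m \<le> real (card (Gen_Mat k n K)) / real c"
    using cpos by (simp add: rc)
  finally show ?thesis using prod by (simp add: c_def mult.assoc)
qed

end
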